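(* Arctic auctions with stepwise marginal costs (i.e. separable convex piecewise-linear costs), whose inputs (bids, supplies, and supply-cost curves) are rationals encoded in binary, reduce in strongly polynomial time to costless Arctic auctions. That is, there are (i) a strongly polynomial forward map taking any Arctic auction $\mathcal{A}$ with stepwise marginal costs to a costless Arctic auction $\widehat{\mathcal{A}}$ that has a competitive equilibrium, and (ii) a strongly polynomial reverse map taking $\mathcal{A}$ and any competitive equilibrium of $\widehat{\mathcal{A}}$ to a competitive equilibrium of $\mathcal{A}$.
   Context: Arctic auction with stepwise marginal costs. There are goods $[n]=\{1,\dots,n\}$ and bids $(\beta^j;\mathbf r^j)$, $j\in[m]$, with budget $\beta^j\in\mathbb R_{\ge 0}$ and value vector $\mathbf r^j\in\mathbb R^n_{\ge 0}$. At prices $\mathbf p\in\mathbb R^n_{>0}$, the demand of bid $j$ is $D^j(\mathbf p)=\operatorname{argmax}\{(\mathbf r^j-\mathbf p)\cdot\mathbf x : \mathbf x\in\mathbb R^n_{\ge 0},\ \mathbf p\cdot\mathbf x\le\beta^j\}$. The auctioneer has cost $C(\mathbf y)=\sum_{i\in[n]}C_i(y_i)$, where $C_i$ has $K_i\ge 1$ steps; step $k\in[K_i]$ has width $s_{ik}>0$ and marginal cost $c_{ik}$, with $0\le c_{i1}<c_{i2}<\dots<c_{iK_i}$. With $S_{i0}=0$, $S_{ik}=\sum_{h=1}^k s_{ih}$ and $s_i=S_{iK_i}$ (the supply cap), $C_i(y_i)=\sum_{k<l}c_{ik}s_{ik}+c_{il}(y_i-S_{i,l-1})$ for $y_i\in[S_{i,l-1},S_{il}]$,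 and $C_i(y_i)=\infty$ for $y_i>s_i$. A competitive equilibrium consists of prices $\mathbf p\in\mathbb R^n_{>0}$ and allocations $\mathbf x^1,\dots,\mathbf x^m$ with $\mathbf x^j\in D^j(\mathbf p)$ for all $j$ and $\mathbf y=\sum_j\mathbf x^j\in\operatorname{argmax}_{\mathbf z\in\mathbb R^n_{\ge 0}}\{\mathbf p\cdot\mathbf z-C(\mathbf z)\}$. A costless Arctic auction is the special case $C_i(y_i)=0$ for $0\le y_i\le s_i$ and $C_i(y_i)=\infty$ for $y_i>s_i$. Standing assumption on all Arctic auctions: every bid has positive value for at least one good, and for every good $i$ there is a bid $j$ with $\beta^j>0$ and $r^j_i>0$. Strongly polynomial: the number of arithmetic operations (including comparisons) is bounded by a polynomial in the numbers of goods, bids, and marginal-cost steps $K=\sum_i K_i$, independently of the number of digits used to represent the input, and (on rational input) all numbers produced have encoding length polynomial in that of the map's input. *)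

theory Defs
  imports Complex_Main "HOL-Library.Extended_Real" "HOL-Library.Log_Nat"
    "HOL-Computational_Algebra.Polynomial"
begin

section \<open>Arctic auctions with stepwise marginal costs\<close>

text \<open>
  Goods, bids and steps are numbered from 0. Vectors and matrices are functions on \<open>nat\<close> of which
  only the entries inside the stated ranges are ever used.
\<close>

record auction =
  goods :: nat
  bids :: nat
  budget :: "nat \<Rightarrow> real"               \<comment> \<open>bid \<open>j\<close>\<close>
  val :: "nat \<Rightarrow> nat \<Rightarrow> real"           \<comment> \<open>bid \<open>j\<close>, good \<open>i\<close>\<close>
  steps :: "nat \<Rightarrow> nat"                 \<comment> \<open>good \<open>i\<close>\<close>
  width :: "nat \<Rightarrow> nat \<Rightarrow> real"         \<comment> \<open>good \<open>i\<close>, step \<open>k\<close>\<close>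
  mcost :: "nat \<Rightarrow> nat \<Rightarrow> real"         \<comment> \<open>good \<open>i\<close>, step \<open>k\<close>\<close>

definition cum_supply :: "auction \<Rightarrow> nat \<Rightarrow> nat \<Rightarrow> real" where
  "cum_supply A i k = (\<Sum>h<k. width A i h)"

definition supply_cap :: "auction \<Rightarrow> nat \<Rightarrow> real" where
  "supply_cap A i = cum_supply A i (steps A i)"

text \<open>
  Step \<open>l\<close> covers the interval from \<open>cum_supply A i l\<close> to \<open>cum_supply A i (Suc l)\<close>. At a common
  endpoint of two adjacent intervals both formulas give the same cost, so taking the least \<open>l\<close> is
  no restriction. The function is only used for nonnegative quantities.
\<close>

definition good_cost :: "auction \<Rightarrow> nat \<Rightarrow> real \<Rightarrow> ereal" where
  "good_cost A i y =
     (if y > supply_cap A i then \<infinity>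
      else let l = (LEAST l. y \<le> cum_supply A i (Suc l))
           in ereal ((\<Sum>k<l. mcost A i k * width A i k)
                      + mcost A i l * (y - cum_supply A i l)))"

definition cost :: "auction \<Rightarrow> (nat \<Rightarrow> real) \<Rightarrow> ereal" where
  "cost A y = (\<Sum>i<goods A. good_cost A i (y i))"

definition demand :: "auction \<Rightarrow> (nat \<Rightarrow> real) \<Rightarrow> nat \<Rightarrow> (nat \<Rightarrow> real) set" where
  "demand A p j =
     {x. is_arg_max (\<lambda>x. \<Sum>i<goods A. (val A j i - p i) * x i)
           (\<lambda>x. (\<forall>i<goods A. 0 \<le> x i) \<and> (\<Sum>i<goods A. p i * x i) \<le> budget A j) x}"

definition competitive_equilibrium ::
  "auction \<Rightarrow> (nat \<Rightarrow> real) \<Rightarrow> (nat \<Rightarrow> nat \<Rightarrow> real) \<Rightarrow> bool" where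
  "competitive_equilibrium A p x \<longleftrightarrow>
     (\<forall>i<goods A. 0 < p i) \<and>
     (\<forall>j<bids A. x j \<in> demand A p j) \<and>
     is_arg_max (\<lambda>z. ereal (\<Sum>i<goods A. p i * z i) - cost A z)
       (\<lambda>z. \<forall>i<goods A. 0 \<le> z i) (\<lambda>i. \<Sum>j<bids A. x j i)"

text \<open>The last two conjuncts are the standing assumption on all Arctic auctions.\<close>

definition arctic_auction :: "auction \<Rightarrow> bool" where
  "arctic_auction A \<longleftrightarrow>
     (\<forall>j<bids A. 0 \<le> budget A j \<and> (\<forall>i<goods A. 0 \<le> val A j i)) \<and>
     (\<forall>i<goods A. 1 \<le> steps A i \<and> (\<forall>k<steps A i. 0 < width A i k) \<and>
        0 \<le> mcost A i 0 \<and> (\<forall>k. Suc k < steps A i \<longrightarrow> mcost A i k < mcost A i (Suc k))) \<and>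
     (\<forall>j<bids A. \<exists>i<goods A. 0 < val A j i) \<and>
     (\<forall>i<goods A. \<exists>j<bids A. 0 < budget A j \<and> 0 < val A j i)"

definition costless :: "auction \<Rightarrow> bool" where
  "costless A \<longleftrightarrow>
     (\<forall>i<goods A. \<forall>y\<ge>0. good_cost A i y = (if y \<le> supply_cap A i then 0 else \<infinity>))"

section \<open>Encoding length\<close>

definition rat_len :: "rat \<Rightarrow> nat" where
  "rat_len q = (case quotient_of q of (a, b) \<Rightarrow>
     1 + floorlog 2 (nat \<bar>a\<bar>) + floorlog 2 (nat b))"

text \<open>Meaningful for rational \<open>x\<close> only; every use is accompanied by a rationality condition.\<close>

definition num_len :: "real \<Rightarrow> nat" where
  "num_len x = rat_len (the_inv real_of_rat x)"

definition rational_auction :: "auction \<Rightarrow> bool" where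
  "rational_auction A \<longleftrightarrow>
     (\<forall>j<bids A. budget A j \<in> \<rat> \<and> (\<forall>i<goods A. val A j i \<in> \<rat>)) \<and>
     (\<forall>i<goods A. \<forall>k<steps A i. width A i k \<in> \<rat> \<and> mcost A i k \<in> \<rat>)"

definition auction_len :: "auction \<Rightarrow> nat" where
  "auction_len A =
     floorlog 2 (goods A) + floorlog 2 (bids A) + (\<Sum>i<goods A. floorlog 2 (steps A i)) +
     (\<Sum>j<bids A. num_len (budget A j) + (\<Sum>i<goods A. num_len (val A j i))) +
     (\<Sum>i<goods A. \<Sum>k<steps A i. num_len (width A i k) + num_len (mcost A i k))"

definition rational_outcome ::
  "auction \<Rightarrow> (nat \<Rightarrow> real) \<Rightarrow> (nat \<Rightarrow> nat \<Rightarrow> real) \<Rightarrow> bool" where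
  "rational_outcome A p x \<longleftrightarrow>
     (\<forall>i<goods A. p i \<in> \<rat>) \<and> (\<forall>j<bids A. \<forall>i<goods A. x j i \<in> \<rat>)"

definition outcome_len ::
  "auction \<Rightarrow> (nat \<Rightarrow> real) \<Rightarrow> (nat \<Rightarrow> nat \<Rightarrow> real) \<Rightarrow> nat" where
  "outcome_len A p x =
     (\<Sum>i<goods A. num_len (p i)) + (\<Sum>j<bids A. \<Sum>i<goods A. num_len (x j i))"

section \<open>Arithmetic random-access machine\<close>

text \<open>
  A program works on finitely many named arrays of two kinds: one-dimensional arrays of natural
  numbers, used for addressing and loop control, and two-dimensional arrays of real numbers, the
  data. Entry 0 of an index array doubles as a scalar index variable. Data can only be added,
  subtracted, multiplied, divided and compared; in particular there is no rounding and no conversion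
  from data to indices. Division is total, with \<open>x / 0 = 0\<close>.
\<close>

record state =
  idx :: "string \<Rightarrow> nat \<Rightarrow> nat"
  num :: "string \<Rightarrow> nat \<Rightarrow> nat \<Rightarrow> real"

text \<open>\<open>Cell a i j\<close> is the entry of array \<open>a\<close> at the current values of the index variables \<open>i\<close>, \<open>j\<close>.\<close>

datatype cell = Cell string string string

datatype index_op =
    IConst nat
  | IAdd string string
  | ISub string string
  | IGet string string

datatype num_op =
    NConst int
  | NCopy cell
  | NAdd cell cell
  | NSub cell cell
  | NMul cell cell
  | NDiv cell cell

datatype test =
    ILess string string
  | NLess cell cell

datatype prog =
    Skip
  | ISet string index_op
  | IPut string string string
  | NSet cell num_op
  | Seq prog prog
  | Cond test prog prog
  | Loop test prog

definition ivar :: "state \<Rightarrow> string \<Rightarrow> nat" where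
  "ivar s v = idx s v 0"

fun cell_val :: "state \<Rightarrow> cell \<Rightarrow> real" where
  "cell_val s (Cell a i j) = num s a (ivar s i) (ivar s j)"

fun index_val :: "state \<Rightarrow> index_op \<Rightarrow> nat" where
  "index_val s (IConst n) = n"
| "index_val s (IAdd u v) = ivar s u + ivar s v"
| "index_val s (ISub u v) = ivar s u - ivar s v"
| "index_val s (IGet a v) = idx s a (ivar s v)"

fun num_val :: "state \<Rightarrow> num_op \<Rightarrow> real" where
  "num_val s (NConst z) = of_int z"
| "num_val s (NCopy u) = cell_val s u"
| "num_val s (NAdd u v) = cell_val s u + cell_val s v"
| "num_val s (NSub u v) = cell_val s u - cell_val s v"
| "num_val s (NMul u v) = cell_val s u * cell_val s v"
| "num_val s (NDiv u v) = cell_val s u / cell_val s v"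

fun test_val :: "state \<Rightarrow> test \<Rightarrow> bool" where
  "test_val s (ILess u v) = (ivar s u < ivar s v)"
| "test_val s (NLess u v) = (cell_val s u < cell_val s v)"

definition put_idx :: "string \<Rightarrow> nat \<Rightarrow> nat \<Rightarrow> state \<Rightarrow> state" where
  "put_idx a i n s = s\<lparr>idx := (idx s)(a := (idx s a)(i := n))\<rparr>"

fun put_num :: "cell \<Rightarrow> real \<Rightarrow> state \<Rightarrow> state" where
  "put_num (Cell a i j) x s =
     s\<lparr>num := (num s)(a := (num s a)(ivar s i := (num s a (ivar s i))(ivar s j := x)))\<rparr>"

text \<open>
  \<open>exec c s tr s'\<close>: started in \<open>s\<close>, the program \<open>c\<close> halts in \<open>s'\<close>, and \<open>tr\<close> lists the states right
  after each executed operation. Every arithmetic operation, copy, index operation and comparison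
  contributes exactly one entry, so \<open>length tr\<close> is the number of operations, and each number
  produced on the way occurs in some state of \<open>tr\<close>.
\<close>

inductive exec :: "prog \<Rightarrow> state \<Rightarrow> state list \<Rightarrow> state \<Rightarrow> bool" where
  Skip: "exec Skip s [] s"
| ISet: "s' = put_idx v 0 (index_val s e) s \<Longrightarrow> exec (ISet v e) s [s'] s'"
| IPut: "s' = put_idx a (ivar s i) (ivar s v) s \<Longrightarrow> exec (IPut a i v) s [s'] s'"
| NSet: "s' = put_num u (num_val s e) s \<Longrightarrow> exec (NSet u e) s [s'] s'"
| Seq: "exec c1 s tr1 s1 \<Longrightarrow> exec c2 s1 tr2 s2 \<Longrightarrow> exec (Seq c1 c2) s (tr1 @ tr2) s2"
| CondT: "test_val s b \<Longrightarrow> exec c1 s tr s' \<Longrightarrow> exec (Cond b c1 c2) s (s # tr) s'"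
| CondF: "\<not> test_val s b \<Longrightarrow> exec c2 s tr s' \<Longrightarrow> exec (Cond b c1 c2) s (s # tr) s'"
| LoopT: "test_val s b \<Longrightarrow> exec c s tr1 s1 \<Longrightarrow> exec (Loop b c) s1 tr2 s2 \<Longrightarrow>
            exec (Loop b c) s (s # tr1 @ tr2) s2"
| LoopF: "\<not> test_val s b \<Longrightarrow> exec (Loop b c) s [s] s"

definition numbers_bounded :: "nat \<Rightarrow> state \<Rightarrow> bool" where
  "numbers_bounded B s \<longleftrightarrow>
     (\<forall>a i. floorlog 2 (idx s a i) \<le> B) \<and>
     (\<forall>a i j. num s a i j \<in> \<rat> \<and> num_len (num s a i j) \<le> B)"

text \<open>
  The map \<open>f\<close> on the domain \<open>D\<close> is computed by one fixed program. Here \<open>load\<close> is the initial state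
  for an input, \<open>read\<close> extracts the output from the final state, \<open>sz\<close> is the combinatorial size
  of an input, \<open>rational\<close> tells whether all its data are rational, and \<open>len\<close> is then its encoding
  length.
\<close>

definition strongly_polynomial ::
  "'i set \<Rightarrow> ('i \<Rightarrow> state) \<Rightarrow> (state \<Rightarrow> 'o) \<Rightarrow> ('i \<Rightarrow> nat) \<Rightarrow> ('i \<Rightarrow> bool) \<Rightarrow> ('i \<Rightarrow> nat) \<Rightarrow>
   ('i \<Rightarrow> 'o) \<Rightarrow> bool" where
  "strongly_polynomial D load read sz rational len f \<longleftrightarrow>
     (\<exists>(c :: prog) (P :: nat poly) (Q :: nat poly). \<forall>i\<in>D. \<exists>tr s'.
        exec c (load i) tr s' \<and> read s' = f i \<and>
        length tr \<le> poly P (sz i) \<and>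
        (rational i \<longrightarrow> (\<forall>s\<in>set tr. numbers_bounded (poly Q (len i)) s)))"

section \<open>Inputs and outputs of the two maps\<close>

text \<open>
  A quantity is bounded by a polynomial in \<open>n\<close>, \<open>m\<close> and \<open>K\<close> iff it is bounded by a univariate
  polynomial in \<open>n + m + K\<close>.
\<close>

definition auction_dim :: "auction \<Rightarrow> nat" where
  "auction_dim A = goods A + bids A + (\<Sum>i<goods A. steps A i)"

definition load_auction :: "auction \<Rightarrow> state" where
  "load_auction A =
     \<lparr>idx = (\<lambda>a i.
        if a = ''n'' \<and> i = 0 then goods A
        else if a = ''m'' \<and> i = 0 then bids A
        else if a = ''K'' \<and> i < goods A then steps A i
        else 0),
      num = (\<lambda>a i j.
        if a = ''beta'' \<and> i < bids A \<and> j = 0 then budget A i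
        else if a = ''r'' \<and> i < bids A \<and> j < goods A then val A i j
        else if a = ''s'' \<and> i < goods A \<and> j < steps A i then width A i j
        else if a = ''c'' \<and> i < goods A \<and> j < steps A i then mcost A i j
        else 0)\<rparr>"

definition read_auction :: "state \<Rightarrow> auction" where
  "read_auction s =
     \<lparr>goods = idx s ''n_out'' 0,
      bids = idx s ''m_out'' 0,
      budget = (\<lambda>j. num s ''beta_out'' j 0),
      val = (\<lambda>j i. num s ''r_out'' j i),
      steps = (\<lambda>i. idx s ''K_out'' i),
      width = (\<lambda>i k. num s ''s_out'' i k),
      mcost = (\<lambda>i k. num s ''c_out'' i k)\<rparr>"

text \<open>An auction \<open>A\<close> together with prices and allocations for the auction \<open>B\<close>.\<close>

definition load_with_outcome ::
  "auction \<Rightarrow> auction \<Rightarrow> (nat \<Rightarrow> real) \<Rightarrow> (nat \<Rightarrow> nat \<Rightarrow> real) \<Rightarrow> state" where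
  "load_with_outcome A B p x =
     (load_auction A)
       \<lparr>num := (\<lambda>a i j.
          if a = ''p_in'' \<and> i < goods B \<and> j = 0 then p i
          else if a = ''x_in'' \<and> i < bids B \<and> j < goods B then x i j
          else num (load_auction A) a i j)\<rparr>"

definition read_outcome :: "state \<Rightarrow> (nat \<Rightarrow> real) \<times> (nat \<Rightarrow> nat \<Rightarrow> real)" where
  "read_outcome s = (\<lambda>i. num s ''p_out'' i 0, \<lambda>j i. num s ''x_out'' j i)"

definition stepwise_inputs :: "auction set" where
  "stepwise_inputs = {A. arctic_auction A \<and> rational_auction A}"

definition strongly_polynomial_forward :: "(auction \<Rightarrow> auction) \<Rightarrow> bool" where
  "strongly_polynomial_forward F \<longleftrightarrow>
     strongly_polynomial stepwise_inputs load_auction read_auction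
       auction_dim rational_auction auction_len F"

text \<open>
  The equilibrium handed to the reverse map may be irrational; the operation bound applies to it
  all the same.
\<close>

definition strongly_polynomial_reverse ::
  "(auction \<Rightarrow> auction) \<Rightarrow>
   (auction \<times> (nat \<Rightarrow> real) \<times> (nat \<Rightarrow> nat \<Rightarrow> real) \<Rightarrow> (nat \<Rightarrow> real) \<times> (nat \<Rightarrow> nat \<Rightarrow> real)) \<Rightarrow> bool"
  where
  "strongly_polynomial_reverse F G \<longleftrightarrow>
     strongly_polynomial
       {(A, p, x). A \<in> stepwise_inputs \<and> competitive_equilibrium (F A) p x}
       (\<lambda>(A, p, x). load_with_outcome A (F A) p x) read_outcome
       (\<lambda>(A, p, x). auction_dim A)
       (\<lambda>(A, p, x). rational_auction A \<and> rational_outcome (F A) p x)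
       (\<lambda>(A, p, x). auction_len A + outcome_len (F A) p x) G"

end

theory Submission imports Defs "HOL-Analysis.Function_Topology" begin

text \<open>
  Split good \<open>i\<close> into one good per step, supplied in the width of that step at no cost, and let an
  additional bid with value \<open>c\<close> and budget \<open>c * s\<close> for this good alone stand for its marginal cost
  \<open>c\<close> and width \<open>s\<close>. In an equilibrium no step is cheaper than its marginal cost, since its additional
  bid would then demand more than the supply, and above the marginal cost the step is sold entirely to
  the original bids. These buy only the cheapest steps of a good, so the least step price serves as
  the price of the good, and every step is sold fully or not at all according to its marginal cost.

  An equilibrium of a costless auction is found by maximizing the sum of the concave functions
  \<open>b * ln (max u b) + min u b\<close> of the gross utilities \<open>u\<close> of bids with budget \<open>b\<close> over all divisions of
  the supply: with the multipliers \<open>l = b / max u b\<close>, the greatest \<open>l * r\<close> over all bids is the price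
  of a good that they value at \<open>r\<close>.
\<close>

section \<open>Existence of equilibria in linear markets\<close>

text \<open>The budget \<open>c * s\<close> is what the additional bid needs to buy the whole width
  at price \<open>c\<close>; with less it could be content with a part of the step at a price below
  \<open>c\<close>. At price \<open>c\<close> itself the bid is indifferent, so it absorbs whatever
  the original bids leave, which mirrors the indifference of the auctioneer between the quantities
  of a step sold at its marginal cost.

  The slope of \<open>bid_util b\<close> at \<open>u\<close> is \<open>b / max u b\<close>, that is
  1 below \<open>b\<close> and \<open>b / u\<close> above. Kept money is worth 1 per unit, so
  multipliers never exceed 1, and a bid whose utility is less than its budget has multiplier 1 and
  keeps the rest of its money.

  Existence is proved without computing anything. The arithmetic of the two programs on data is one
  product per step in the forward map and, in the reverse map, one sum of allocations per bid and
  good; the rest is copying, comparing and writing the constant 1. Hence encoding lengths grow only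
  linearly, although every intermediate number counts.\<close>

definition bid_util :: "real \<Rightarrow> real \<Rightarrow> real" where
  "bid_util b u = b * ln (max u b) + min u b"

text \<open>Since \<open>max u b + min u b = u + b\<close>, the change \<open>v - u\<close> splits
  into the change of \<open>max _ b\<close>, handled by \<open>ln x \<le> x - 1\<close>, and the
  change of \<open>min _ b\<close>, on which \<open>bid_util\<close> is linear. At budget 0 both
  sides vanish.\<close>

lemma bid_util_tangent:
  assumes "0 \<le> b" "0 \<le> u" "0 \<le> v"
  shows "bid_util b v \<le> bid_util b u + b / max u b * (v - u)"
proof (cases "b = 0")
  case True
  then show ?thesis using assms by (simp add: bid_util_def)
next
  case False
  define u' v' where "u' = max u b" and "v' = max v b"
  have b: "0 < b" and u': "0 < u'" "b \<le> u'" and v': "0 < v'"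
    using assms False by (auto simp: u'_def v'_def)
  have "ln v' - ln u' \<le> v' / u' - 1"
    using ln_le_minus_one[of "v' / u'"] u' v' by (simp add: ln_div)
  then have "b * (ln v' - ln u') \<le> b * (v' / u' - 1)"
    using b by (intro mult_left_mono) auto
  then have 1: "b * ln v' - b * ln u' \<le> b / u' * (v' - u')"
    using u' by (simp add: field_simps)
  \<comment> \<open>Below \<open>b\<close> the slope is 1. Otherwise \<open>min u b\<close> has its
    greatest value \<open>b\<close>, so the change is nonpositive and a factor of at most 1 can only
    increase it.\<close>
  have 2: "min v b - min u b \<le> b / u' * (min v b - min u b)"
  proof (cases "u < b")
    case True
    then show ?thesis using b by (simp add: u'_def max_def)
  next
    case False
    then have "(1 - b / u') * (min v b - min u b) \<le> 0"
      using u' by (intro mult_nonneg_nonpos) auto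
    then show ?thesis by (simp add: algebra_simps)
  qed
  have "v - u = (v' - u') + (min v b - min u b)"
    by (auto simp: u'_def v'_def)
  then have "b / u' * (v - u) = b / u' * (v' - u') + b / u' * (min v b - min u b)"
    by (simp only: distrib_left)
  with 1 2 show ?thesis
    unfolding bid_util_def u'_def[symmetric] v'_def[symmetric] by linarith
qed

section \<open>Compactness and convexity of the set of divisions of the supply\<close>

lemma compact_box:
  fixes s :: "'a \<Rightarrow> real"
  shows "compact {X. \<forall>k. 0 \<le> X k \<and> X k \<le> s k}"
proof -
  have "compactin (product_topology (\<lambda>_. euclidean) UNIV) (PiE UNIV (\<lambda>k. {0..s k}))"
    by (subst compactin_PiE) auto
  moreover have "PiE UNIV (\<lambda>k. {0..s k}) = {X. \<forall>k. 0 \<le> X k \<and> X k \<le> s k}"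
    by (auto simp: PiE_def Pi_def extensional_def)
  ultimately show ?thesis
    by (simp add: euclidean_product_topology)
qed

lemma continuous_on_coordinate [continuous_intros]:
  "continuous_on S (\<lambda>x::'a \<Rightarrow> real. x i)"
  by (rule continuous_on_subset[OF continuous_on_product_coordinates]) auto

text \<open>All pairs of naturals are indices, so entries outside the market are pinned to 0: the
  set then lies in a product of compact intervals. Supply may remain unsold; that the maximizer
  sells everything is a later consequence of positive prices.\<close>

definition feasible :: "nat \<Rightarrow> nat \<Rightarrow> (nat \<Rightarrow> real) \<Rightarrow> (nat \<times> nat \<Rightarrow> real) set" where
  "feasible n m s =
     {X. \<forall>k. 0 \<le> X k \<and> X k \<le> (if fst k < m \<and> snd k < n then s (snd k) else 0)} \<inter>
     {X. \<forall>i<n. (\<Sum>j<m. X (j, i)) \<le> s i}"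

lemma compact_feasible: "compact (feasible n m s)"
proof -
  have "{X::nat \<times> nat \<Rightarrow> real. \<forall>i<n. (\<Sum>j<m. X (j, i)) \<le> s i} =
        (\<Inter>i\<in>{..<n}. {X. (\<Sum>j<m. X (j, i)) \<le> s i})" by auto
  moreover have "closed (\<Inter>i\<in>{..<n}. {X::nat \<times> nat \<Rightarrow> real. (\<Sum>j<m. X (j, i)) \<le> s i})"
    by (intro closed_INT ballI closed_Collect_le continuous_intros)
  ultimately show ?thesis
    unfolding feasible_def by (intro compact_Int_closed compact_box) simp
qed

lemma feasible_convex:
  assumes "X \<in> feasible n m s" "Y \<in> feasible n m s" "0 \<le> t" "t \<le> 1"
  shows "(\<lambda>k. X k + t * (Y k - X k)) \<in> feasible n m s"
proof -
  have eq: "X k + t * (Y k - X k) = (1 - t) * X k + t * Y k" for k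
    by (simp add: algebra_simps)
  have conv: "(1 - t) * a + t * b \<le> c" if "a \<le> c" "b \<le> c" for a b c :: real
  proof -
    have "(1 - t) * a + t * b \<le> (1 - t) * c + t * c"
      using that assms by (intro add_mono mult_left_mono) auto
    then show ?thesis by (simp add: algebra_simps)
  qed
  have "(\<Sum>j<m. (1 - t) * X (j, i) + t * Y (j, i)) \<le> s i" if "i < n" for i
    using conv[of "\<Sum>j<m. X (j, i)" "s i" "\<Sum>j<m. Y (j, i)"] assms that
    by (simp add: sum.distrib sum_distrib_left feasible_def)
  moreover have "0 \<le> (1 - t) * X k + t * Y k" for k
    using assms by (cases k) (auto simp: feasible_def)
  moreover have "(1 - t) * X k + t * Y k \<le> (if fst k < m \<and> snd k < n then s (snd k) else 0)" for k
    using assms(1,2) by (intro conv) (simp_all add: feasible_def del: split_paired_All)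
  ultimately show ?thesis
    unfolding eq by (simp add: feasible_def del: split_paired_All)
qed

text \<open>
  The maximizer of the concave program also maximizes its own linearization. Derivatives are
  avoided: the tangent inequality is applied at points approaching the maximizer.
\<close>

lemma linearized_optimum:
  fixes r :: "nat \<Rightarrow> nat \<Rightarrow> real"
  assumes b: "\<And>j. j < m \<Longrightarrow> 0 \<le> b j"
    and r: "\<And>i j. i < n \<Longrightarrow> j < m \<Longrightarrow> 0 \<le> r j i"
    and s: "\<And>i. i < n \<Longrightarrow> 0 \<le> s i"
  obtains X where "X \<in> feasible n m s"
    and "\<And>Y. Y \<in> feasible n m s \<Longrightarrow>
      (\<Sum>j<m. b j / max (\<Sum>i<n. r j i * X (j, i)) (b j) * (\<Sum>i<n. r j i * (Y (j, i) - X (j, i)))) \<le> 0"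
proof -
  define u where "u = (\<lambda>X j. \<Sum>i<n. r j i * X (j, i))"
  define f where "f = (\<lambda>X. \<Sum>j<m. bid_util (b j) (u X j))"
  have cont_u: "continuous_on S (\<lambda>X. u X j)" for S j
    unfolding u_def by (intro continuous_intros)
  have "continuous_on S (\<lambda>X. bid_util (b j) (u X j))" if "j < m" for S j
  proof (cases "b j = 0")
    case True
    then show ?thesis
      unfolding bid_util_def by (simp add: continuous_on_min cont_u)
  next
    case False
    with b that have "0 < b j" by force
    then show ?thesis unfolding bid_util_def
      by (intro continuous_intros cont_u) (auto simp: max_def)
  qed
  then have "continuous_on (feasible n m s) f"
    unfolding f_def by (intro continuous_on_sum) auto
  moreover have "(\<lambda>_. 0) \<in> feasible n m s"
    using s by (auto simp: feasible_def)
  ultimately obtain X where X: "X \<in> feasible n m s"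
    and max: "\<And>Y. Y \<in> feasible n m s \<Longrightarrow> f Y \<le> f X"
    using continuous_attains_sup[OF compact_feasible[of n m s], of f] by blast
  show thesis
  proof
    show "X \<in> feasible n m s" by (rule X)
  next
    fix Y assume Y: "Y \<in> feasible n m s"
    define d where "d = (\<lambda>j. \<Sum>i<n. r j i * (Y (j, i) - X (j, i)))"
    define g where "g = (\<lambda>t. \<Sum>j<m. b j / max (u X j + t * d j) (b j) * d j)"
    have u_nonneg: "0 \<le> u Z j" if "Z \<in> feasible n m s" "j < m" for Z j
      using that r unfolding u_def by (intro sum_nonneg) (auto simp: feasible_def)
    \<comment> \<open>The tangent is taken at the point \<open>Z\<close> of the segment and
      evaluated at \<open>X\<close>; as \<open>f Z\<close> is at most \<open>f X\<close>, what
      remains is \<open>t * g t \<le> 0\<close>.\<close>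
    have g_le: "g t \<le> 0" if t: "0 < t" "t \<le> 1" for t
    proof -
      define Z where "Z = (\<lambda>k. X k + t * (Y k - X k))"
      have Z: "Z \<in> feasible n m s"
        unfolding Z_def using feasible_convex[OF X Y] t by simp
      have uZ: "u Z j = u X j + t * d j" for j
        by (simp add: u_def d_def Z_def algebra_simps sum.distrib sum_distrib_left sum_subtractf)
      have "f X \<le> (\<Sum>j<m. bid_util (b j) (u Z j) + b j / max (u Z j) (b j) * (u X j - u Z j))"
        unfolding f_def by (intro sum_mono bid_util_tangent b u_nonneg X Z) auto
      also have "\<dots> = f Z - t * g t"
        by (simp add: f_def g_def uZ sum.distrib sum_distrib_left sum_negf sum_subtractf mult.commute mult.left_commute)
      also have "\<dots> \<le> f X - t * g t" using max[OF Z] by simp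
      finally show ?thesis using t by (simp add: mult_le_0_iff)
    qed
    \<comment> \<open>A positive budget keeps the denominators away from 0; with budget 0 the
      summand is constantly 0.\<close>
    have "(g \<longlongrightarrow> g 0) (at_right 0)"
    proof -
      have "((\<lambda>t. b j / max (u X j + t * d j) (b j) * d j) \<longlongrightarrow> b j / max (u X j + 0 * d j) (b j) * d j)
              (at_right 0)" if "j < m" for j
      proof (cases "b j = 0")
        case False
        with b that have "0 < b j" by force
        then show ?thesis by (intro tendsto_intros) auto
      qed simp
      then show ?thesis unfolding g_def by (intro tendsto_sum) auto
    qed
    moreover have "eventually (\<lambda>t. g t \<le> 0) (at_right 0)"
      using g_le by (auto simp: eventually_at_right_field intro!: exI[of _ 1])
    ultimately have "g 0 \<le> 0"
      by (intro tendsto_upperbound) auto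
    then show "(\<Sum>j<m. b j / max (\<Sum>i<n. r j i * X (j, i)) (b j) * (\<Sum>i<n. r j i * (Y (j, i) - X (j, i)))) \<le> 0"
      by (simp add: g_def u_def d_def)
  qed
qed

text \<open>Complementary slackness. With the multipliers \<open>l\<close> fixed, the best division
  gives each good to bids attaining its price \<open>p i\<close>, for a total of the sum of
  \<open>p i * s i\<close>. The linearized optimum reaches this total, so it sells everything, and
  only to such bids. Each bid then receives the best ratio of value to price, namely
  \<open>1 / l j\<close>.\<close>

lemma linear_market_equilibrium:
  fixes r :: "nat \<Rightarrow> nat \<Rightarrow> real"
  assumes b: "\<And>j. j < m \<Longrightarrow> 0 \<le> b j"
    and r: "\<And>i j. i < n \<Longrightarrow> j < m \<Longrightarrow> 0 \<le> r j i"
    and s: "\<And>i. i < n \<Longrightarrow> 0 \<le> s i"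
    and dem: "\<And>i. i < n \<Longrightarrow> \<exists>j<m. 0 < b j \<and> 0 < r j i"
  obtains p x where "\<And>i. i < n \<Longrightarrow> 0 < p i"
    and "\<And>i j. i < n \<Longrightarrow> j < m \<Longrightarrow> 0 \<le> x j i"
    and "\<And>i. i < n \<Longrightarrow> (\<Sum>j<m. x j i) = s i"
    and "\<And>j. j < m \<Longrightarrow> (\<Sum>i<n. p i * x j i) \<le> b j"
    and "\<And>j z. j < m \<Longrightarrow> (\<And>i. i < n \<Longrightarrow> 0 \<le> z i) \<Longrightarrow> (\<Sum>i<n. p i * z i) \<le> b j \<Longrightarrow>
      (\<Sum>i<n. (r j i - p i) * z i) \<le> (\<Sum>i<n. (r j i - p i) * x j i)"
proof -
  obtain X where X: "X \<in> feasible n m s"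
    and opt: "\<And>Y. Y \<in> feasible n m s \<Longrightarrow>
      (\<Sum>j<m. b j / max (\<Sum>i<n. r j i * X (j, i)) (b j) * (\<Sum>i<n. r j i * (Y (j, i) - X (j, i)))) \<le> 0"
    using linearized_optimum[of m b n r s] b r s by blast
  define u where "u = (\<lambda>j. \<Sum>i<n. r j i * X (j, i))"
  define l where "l = (\<lambda>j. b j / max (u j) (b j))"
  have X0: "0 \<le> X (j, i)" for i j using X by (simp add: feasible_def)
  have Xs: "(\<Sum>j<m. X (j, i)) \<le> s i" if "i < n" for i using X that by (simp add: feasible_def)
  have u0: "0 \<le> u j" if "j < m" for j
    unfolding u_def using r X0 that by (intro sum_nonneg) auto
  have l0: "0 \<le> l j" "l j \<le> 1" if "j < m" for j
    using b[OF that] by (auto simp: l_def max_def divide_le_eq)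
  have "\<exists>j<m. \<forall>j'<m. l j' * r j' i \<le> l j * r j i" if "i < n" for i
  proof -
    have ne: "{..<m} \<noteq> {}" using dem[OF that] by auto
    have "Max ((\<lambda>j. l j * r j i) ` {..<m}) \<in> (\<lambda>j. l j * r j i) ` {..<m}"
      using ne by (intro Max_in) auto
    then obtain j where "j < m" "l j * r j i = Max ((\<lambda>j. l j * r j i) ` {..<m})" by auto
    then show ?thesis by (intro exI[of _ j]) auto
  qed
  then obtain J where J: "\<And>i. i < n \<Longrightarrow> J i < m"
    and Jmax: "\<And>i j. i < n \<Longrightarrow> j < m \<Longrightarrow> l j * r j i \<le> l (J i) * r (J i) i"
    by metis
  define p where "p = (\<lambda>i. l (J i) * r (J i) i)"
  have pmax: "l j * r j i \<le> p i" if "i < n" "j < m" for i j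
    using Jmax that by (simp add: p_def)
  have p0: "0 < p i" if i: "i < n" for i
  proof -
    obtain j where j: "j < m" "0 < b j" "0 < r j i" using dem[OF i] by blast
    then have "0 < l j" by (simp add: l_def max_def)
    with j have "0 < l j * r j i" by simp
    with pmax[OF i j(1)] show ?thesis by simp
  qed
  have tight: "p i * X (j, i) = l j * r j i * X (j, i) \<and> (\<Sum>j<m. X (j, i)) = s i"
    if ij: "i < n" "j < m" for i j
  proof -
    \<comment> \<open>The competitor to \<open>X\<close>: all of good \<open>i\<close> goes to a
      single bid attaining its price.\<close>
    define Y where "Y = (\<lambda>(j, i). if i < n \<and> j = J i then s i else 0)"
    have sumY: "(\<Sum>j<m. c j * Y (j, i)) = c (J i) * s i" if "i < n" for i and c :: "nat \<Rightarrow> real"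
      using that J[OF that] by (simp add: Y_def if_distrib sum.delta cong: if_cong)
    have "Y \<in> feasible n m s"
      using s J sumY[of _ "\<lambda>_. 1"] by (auto simp: feasible_def Y_def)
    from opt[OF this] have "(\<Sum>j<m. l j * (\<Sum>i<n. r j i * (Y (j, i) - X (j, i)))) \<le> 0"
      by (simp add: l_def u_def)
    also have "(\<Sum>j<m. l j * (\<Sum>i<n. r j i * (Y (j, i) - X (j, i)))) =
       (\<Sum>i<n. \<Sum>j<m. l j * r j i * Y (j, i)) - (\<Sum>i<n. \<Sum>j<m. l j * r j i * X (j, i))"
      unfolding sum_subtractf[symmetric] sum_distrib_left
      by (subst sum.swap) (simp add: algebra_simps)
    also have "(\<Sum>i<n. \<Sum>j<m. l j * r j i * Y (j, i)) = (\<Sum>i<n. p i * s i)"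
      using sumY[of _ "\<lambda>j. l j * r j _"] by (intro sum.cong) (auto simp: p_def sumY)
    finally have A: "(\<Sum>i<n. p i * s i) \<le> (\<Sum>i<n. \<Sum>j<m. l j * r j i * X (j, i))" by simp
    \<comment> \<open>The gap between the two totals, written as the worth of unsold supply
      \<open>e\<close> plus the loss \<open>h\<close> on units held by bids that do not attain the
      price. All terms are nonnegative, so a nonpositive gap makes each of them 0.\<close>
    define e where "e = (\<lambda>i. p i * (s i - (\<Sum>j<m. X (j, i))))"
    define h where "h = (\<lambda>i j. (p i - l j * r j i) * X (j, i))"
    have e0: "0 \<le> e i" if "i < n" for i
      using p0[OF that] Xs[OF that] by (simp add: e_def)
    have h0: "0 \<le> h i j" if "i < n" "j < m" for i j
      using pmax[OF that] X0 by (simp add: h_def)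
    have "(\<Sum>i<n. e i + (\<Sum>j<m. h i j)) = (\<Sum>i<n. p i * s i) - (\<Sum>i<n. \<Sum>j<m. l j * r j i * X (j, i))"
      by (simp add: e_def h_def algebra_simps sum.distrib sum_subtractf sum_distrib_left)
    with A have "(\<Sum>i<n. e i + (\<Sum>j<m. h i j)) \<le> 0" by simp
    moreover have nn: "0 \<le> e i + (\<Sum>j<m. h i j)" if "i < n" for i
      using e0 h0 that by (intro add_nonneg_nonneg sum_nonneg) auto
    ultimately have "(\<Sum>i<n. e i + (\<Sum>j<m. h i j)) = 0"
      by (meson antisym lessThan_iff sum_nonneg)
    then have "e i + (\<Sum>j<m. h i j) = 0"
      using nn ij by (subst (asm) sum_nonneg_eq_0_iff) auto
    moreover have sh: "0 \<le> (\<Sum>j<m. h i j)" using h0 ij by (intro sum_nonneg) auto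
    ultimately have "e i = 0" "(\<Sum>j<m. h i j) = 0" using e0 ij by force+
    then have "e i = 0" "h i j = 0"
      using h0 ij sum_nonneg_eq_0_iff[of "{..<m}" "h i"] by auto
    then show ?thesis using p0[OF ij(1)] by (auto simp: e_def h_def algebra_simps)
  qed
  have sold: "(\<Sum>j<m. X (j, i)) = s i" if "i < n" for i
    using tight[OF that] J[OF that] by blast
  have spend: "(\<Sum>i<n. p i * X (j, i)) = l j * u j" if "j < m" for j
    unfolding u_def sum_distrib_left using tight that by (intro sum.cong) (simp_all only: lessThan_iff mult.assoc)
  have spend_le: "(\<Sum>i<n. p i * X (j, i)) \<le> b j" if "j < m" for j
  proof -
    have "l j * u j \<le> l j * max (u j) (b j)" using l0[OF that] by (intro mult_left_mono) auto
    also have "\<dots> \<le> b j" using b[OF that] by (simp add: l_def)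
    finally show ?thesis using spend[OF that] by simp
  qed
  have best: "(\<Sum>i<n. (r j i - p i) * z i) \<le> (\<Sum>i<n. (r j i - p i) * X (j, i))"
    if j: "j < m" and z: "\<And>i. i < n \<Longrightarrow> 0 \<le> z i" and bud: "(\<Sum>i<n. p i * z i) \<le> b j" for j z
  proof (cases "b j = 0")
    case True
    have zero: "(\<Sum>i<n. (r j i - p i) * w i) = 0"
      if "\<And>i. i < n \<Longrightarrow> 0 \<le> w i" "(\<Sum>i<n. p i * w i) \<le> 0" for w
    proof -
      have "(\<Sum>i<n. p i * w i) = 0"
        using that p0 by (intro antisym sum_nonneg) (auto simp: less_imp_le)
      then have "p i * w i = 0" if "i < n" for i
        using \<open>\<And>i. i < n \<Longrightarrow> 0 \<le> w i\<close> p0 that by (subst (asm) sum_nonneg_eq_0_iff) (auto simp: less_imp_le)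
      then have "w i = 0" if "i < n" for i using p0 that by force
      then show ?thesis by simp
    qed
    show ?thesis
      using zero[of z] zero[of "\<lambda>i. X (j, i)"] z bud X0 spend_le[OF j] True by simp
  next
    case False
    then have bpos: "0 < b j" using b[OF j] by simp
    then have lpos: "0 < l j" by (simp add: l_def max_def)
    \<comment> \<open>The greatest net gain per unit of money; it is nonnegative because multipliers
      are at most 1.\<close>
    define k where "k = 1 / l j - 1"
    have k0: "0 \<le> k" using l0[OF j] lpos by (simp add: k_def)
    have "(r j i - p i) * z i \<le> k * (p i * z i)" if i: "i < n" for i
    proof -
      have "r j i \<le> p i / l j"
        using pmax[OF i j] lpos by (simp add: pos_le_divide_eq mult.commute)
      then have "r j i - p i \<le> k * p i" by (simp add: k_def algebra_simps)
      then have "(r j i - p i) * z i \<le> (k * p i) * z i" using z[OF i] by (rule mult_right_mono)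
      then show ?thesis by (simp add: mult.assoc)
    qed
    then have "(\<Sum>i<n. (r j i - p i) * z i) \<le> k * (\<Sum>i<n. p i * z i)"
      unfolding sum_distrib_left by (intro sum_mono) auto
    also have "\<dots> \<le> k * b j" using bud k0 by (rule mult_left_mono)
    \<comment> \<open>Either the utility is below the budget and \<open>k\<close> is 0, so unspent
      money forgoes nothing, or \<open>l j * u j\<close> equals the budget.\<close>
    also have "k * b j = k * (l j * u j)"
    proof (cases "u j < b j")
      case True
      then have "l j = 1" using bpos by (simp add: l_def max_def)
      then show ?thesis by (simp add: k_def)
    next
      case False
      then show ?thesis using bpos by (simp add: l_def max_def)
    qed
    also have "\<dots> = u j - l j * u j" using lpos by (simp add: k_def algebra_simps)
    also have "\<dots> = (\<Sum>i<n. (r j i - p i) * X (j, i))"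
      unfolding spend[OF j, symmetric] by (simp add: u_def algebra_simps sum_subtractf)
    finally show ?thesis .
  qed
  show thesis
    by (rule that[of p "\<lambda>j i. X (j, i)"]) (use p0 X0 sold spend_le best in auto)
qed

section \<open>Demand\<close>

lemma is_arg_max_linorder:
  fixes f :: "'a \<Rightarrow> 'b::linorder"
  shows "is_arg_max f P x \<longleftrightarrow> P x \<and> (\<forall>y. P y \<longrightarrow> f y \<le> f x)"
  by (auto simp: is_arg_max_def not_less)

lemma demand_iff:
  "x \<in> demand A p j \<longleftrightarrow>
     (\<forall>i<goods A. 0 \<le> x i) \<and> (\<Sum>i<goods A. p i * x i) \<le> budget A j \<and>
     (\<forall>z. (\<forall>i<goods A. 0 \<le> z i) \<and> (\<Sum>i<goods A. p i * z i) \<le> budget A j \<longrightarrow>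
        (\<Sum>i<goods A. (val A j i - p i) * z i) \<le> (\<Sum>i<goods A. (val A j i - p i) * x i))"
  by (auto simp: demand_def is_arg_max_linorder)

lemma sum_fun_upd:
  fixes c :: "nat \<Rightarrow> real"
  assumes "h < n"
  shows "(\<Sum>i<n. c i * (x(h := y)) i) = (\<Sum>i<n. c i * x i) + c h * (y - x h)"
proof -
  have "(\<Sum>i<n. c i * (x(h := y)) i) = (\<Sum>i<n. c i * x i + (if i = h then c h * (y - x h) else 0))"
    by (intro sum.cong) (auto simp: algebra_simps)
  then show ?thesis using assms by (simp add: sum.distrib)
qed

context
  fixes A p j x
  assumes x: "x \<in> demand A p j" and p: "\<And>i. i < goods A \<Longrightarrow> 0 < p i"
begin

text \<open>Giving up a good worth less than its price stays within the budget and gains.\<close>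

lemma demand_val_ge_price:
  assumes i: "i < goods A" "0 < x i"
  shows "p i \<le> val A j i"
proof (rule ccontr)
  assume "\<not> ?thesis"
  then have neg: "(val A j i - p i) * (0 - x i) > 0" using i by (simp add: mult_less_0_iff)
  have "0 < p i * x i" using i p by simp
  then have "(\<Sum>h<goods A. p h * (x(i := 0)) h) \<le> budget A j"
    using x i by (simp only: sum_fun_upd demand_iff) (auto simp: algebra_simps)
  then have "(\<Sum>h<goods A. (val A j h - p h) * (x(i := 0)) h) \<le> (\<Sum>h<goods A. (val A j h - p h) * x h)"
    using x by (simp add: demand_iff)
  with neg show False using i by (simp add: sum_fun_upd del: fun_upd_apply)
qed

text \<open>The money spent on \<open>i\<close> would buy \<open>x i * p i / p h\<close> units of
  \<open>h\<close>; this exchange leaves the expenditure unchanged and must not gain.\<close>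

lemma demand_best_ratio:
  assumes i: "i < goods A" "0 < x i" and h: "h < goods A"
  shows "val A j h * p i \<le> val A j i * p h"
proof (cases "h = i")
  case False
  define z where "z = x(i := 0, h := x h + x i * p i / p h)"
  have z: "(\<Sum>k<goods A. c k * z k) = (\<Sum>k<goods A. c k * x k) - c i * x i + c h * (x i * p i / p h)"
    for c :: "nat \<Rightarrow> real"
    using i h False by (simp only: z_def sum_fun_upd) (simp add: algebra_simps)
  have "\<forall>k<goods A. 0 \<le> z k"
    using x i h p[OF i(1)] p[OF h] by (auto simp: z_def demand_iff)
  moreover have "(\<Sum>k<goods A. p k * z k) \<le> budget A j"
    using x p[OF h] by (simp add: z demand_iff)
  ultimately have "(\<Sum>k<goods A. (val A j k - p k) * z k) \<le> (\<Sum>k<goods A. (val A j k - p k) * x k)"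
    using x by (simp add: demand_iff)
  then have "(val A j h - p h) * (x i * p i / p h) \<le> (val A j i - p i) * x i"
    by (simp add: z)
  then have "x i * ((val A j h - p h) * (p i / p h)) \<le> x i * (val A j i - p i)"
    by (simp add: mult.commute mult.left_commute)
  then have "(val A j h - p h) * (p i / p h) \<le> val A j i - p i"
    using i by (simp only: mult_le_cancel_left_pos)
  then show ?thesis using p[OF h] by (simp add: field_simps)
qed simp

text \<open>Leftover money would buy more of \<open>h\<close> at a strictly positive margin.\<close>

lemma demand_budget_spent:
  assumes h: "h < goods A" "p h < val A j h"
  shows "(\<Sum>i<goods A. p i * x i) = budget A j"
proof (rule ccontr)
  assume ne: "\<not> ?thesis"
  define e where "e = (budget A j - (\<Sum>i<goods A. p i * x i)) / p h"
  have e: "0 < e" using x ne p[OF h(1)] by (simp add: e_def demand_iff)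
  define z where "z = x(h := x h + e)"
  have "\<forall>k<goods A. 0 \<le> z k" using x e by (simp add: z_def demand_iff)
  moreover have "(\<Sum>k<goods A. p k * z k) \<le> budget A j"
    using h p[OF h(1)] by (simp only: z_def sum_fun_upd) (simp add: e_def)
  ultimately have "(\<Sum>k<goods A. (val A j k - p k) * z k) \<le> (\<Sum>k<goods A. (val A j k - p k) * x k)"
    using x by (simp add: demand_iff)
  then have "(val A j h - p h) * e \<le> 0" using h by (simp only: z_def sum_fun_upd) simp
  then show False using h e by (simp add: mult_le_0_iff)
qed

lemma demand_zero_budget:
  assumes "budget A j = 0" "i < goods A"
  shows "x i = 0"
proof -
  have nonneg: "0 \<le> p k * x k" if "k < goods A" for k
    using x p[OF that] that by (simp add: demand_iff)
  then have "(\<Sum>k<goods A. p k * x k) = 0"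
    using x assms by (intro antisym sum_nonneg) (auto simp: demand_iff)
  then have "p i * x i = 0"
    using nonneg assms by (subst (asm) sum_nonneg_eq_0_iff) auto
  then show ?thesis using p[OF assms(2)] by simp
qed

end

section \<open>Optimal supply\<close>

lemma cum_supply_Suc [simp]: "cum_supply A i (Suc k) = cum_supply A i k + width A i k"
  by (simp add: cum_supply_def)

lemma cum_supply_0 [simp]: "cum_supply A i 0 = 0"
  by (simp add: cum_supply_def)

lemma cum_supply_mono:
  assumes "\<And>k. k < K \<Longrightarrow> 0 \<le> width A i k" "k \<le> l" "l \<le> K"
  shows "cum_supply A i k \<le> cum_supply A i l"
  unfolding cum_supply_def using assms by (intro sum_mono2) auto

text \<open>The part of step \<open>k\<close> in use when \<open>y\<close> units are supplied in the
  order of the steps.\<close>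

definition fill :: "auction \<Rightarrow> nat \<Rightarrow> real \<Rightarrow> nat \<Rightarrow> real" where
  "fill A i y k = max 0 (min (width A i k) (y - cum_supply A i k))"

lemma sum_fill:
  assumes "\<And>k. k < K \<Longrightarrow> 0 \<le> width A i k" "0 \<le> y"
  shows "(\<Sum>k<K. fill A i y k) = min y (cum_supply A i K)"
  using assms(1)
proof (induction K)
  case 0
  then show ?case using assms(2) by simp
next
  case (Suc K)
  then have "0 \<le> width A i K" "(\<Sum>k<K. fill A i y k) = min y (cum_supply A i K)" by auto
  then show ?case by (auto simp: fill_def)
qed

text \<open>Steps before the least admissible \<open>l\<close> are full, \<open>l\<close> is partly
  used and later ones are empty. The cost becomes a sum over steps, so that the profit can be
  bounded step by step.\<close>

lemma good_cost_fill:
  assumes w: "\<And>k. k < steps A i \<Longrightarrow> 0 < width A i k" and K: "1 \<le> steps A i"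
    and y: "0 \<le> y" "y \<le> supply_cap A i"
  shows "good_cost A i y = ereal (\<Sum>k<steps A i. mcost A i k * fill A i y k)"
proof -
  define K where "K = steps A i"
  define l where "l = (LEAST l. y \<le> cum_supply A i (Suc l))"
  have ex: "y \<le> cum_supply A i (Suc (K - 1))"
    using y K by (simp add: supply_cap_def K_def del: cum_supply_Suc)
  then have l1: "y \<le> cum_supply A i (Suc l)" unfolding l_def by (rule LeastI)
  have "l \<le> K - 1" unfolding l_def using ex by (rule Least_le)
  then have lK: "l < K" using K by (simp add: K_def)
  have before: "cum_supply A i (Suc k) < y" if "k < l" for k
    using not_less_Least[of k "\<lambda>l. y \<le> cum_supply A i (Suc l)"] that by (simp add: l_def not_le)
  have at: "cum_supply A i l \<le> y"
  proof (cases l)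
    case 0
    then show ?thesis using y by simp
  next
    case (Suc k)
    then show ?thesis using before[of k] by simp
  qed
  have mono: "cum_supply A i a \<le> cum_supply A i b" if "a \<le> b" "b \<le> K" for a b
    using that w by (intro cum_supply_mono[of K]) (auto simp: K_def less_imp_le)
  have f1: "fill A i y k = width A i k" if "k < l" for k
    using before[OF that] w[of k] that lK by (simp add: fill_def K_def)
  have f2: "fill A i y l = y - cum_supply A i l"
    using at l1 by (simp add: fill_def)
  have f3: "fill A i y k = 0" if "l < k" "k < K" for k
    using l1 mono[of "Suc l" k] that w[of k] by (simp add: fill_def K_def)
  have split: "{..<K} = {..<l} \<union> insert l {Suc l..<K}" using lK by auto
  have "(\<Sum>k<K. mcost A i k * fill A i y k) =
      (\<Sum>k<l. mcost A i k * fill A i y k) + (mcost A i l * fill A i y l + (\<Sum>k=Suc l..<K. mcost A i k * fill A i y k))"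
    unfolding split by (subst sum.union_disjoint) auto
  also have "\<dots> = (\<Sum>k<l. mcost A i k * width A i k) + mcost A i l * (y - cum_supply A i l)"
    using f1 f2 f3 by simp
  finally show ?thesis
    using y by (simp add: good_cost_def Let_def l_def[symmetric] K_def[symmetric] del: cum_supply_Suc)
qed

lemma good_cost_above: "supply_cap A i < y \<Longrightarrow> good_cost A i y = \<infinity>"
  by (simp add: good_cost_def)

text \<open>
  A seller of good \<open>i\<close> at price \<open>p\<close> earns at most the margins of the steps cheaper than \<open>p\<close>;
  selling those steps entirely and no dearer ones attains this bound.
\<close>

lemma seller_optimal:
  assumes A: "arctic_auction A"
    and v: "\<And>i k. i < goods A \<Longrightarrow> k < steps A i \<Longrightarrow> 0 \<le> v i k \<and> v i k \<le> width A i k"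
    and full: "\<And>i k. i < goods A \<Longrightarrow> k < steps A i \<Longrightarrow> mcost A i k < p i \<Longrightarrow> v i k = width A i k"
    and none: "\<And>i k. i < goods A \<Longrightarrow> k < steps A i \<Longrightarrow> p i < mcost A i k \<Longrightarrow> v i k = 0"
    and Y: "\<And>i. i < goods A \<Longrightarrow> Y i = (\<Sum>k<steps A i. v i k)"
  shows "is_arg_max (\<lambda>z. ereal (\<Sum>i<goods A. p i * z i) - cost A z) (\<lambda>z. \<forall>i<goods A. 0 \<le> z i) Y"
proof -
  have K: "1 \<le> steps A i" and w: "\<And>k. k < steps A i \<Longrightarrow> 0 < width A i k" if "i < goods A" for i
    using A that by (auto simp: arctic_auction_def)
  have inc: "mcost A i a < mcost A i b" if "i < goods A" "a < b" "b < steps A i" for i a b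
    using that(2,3)
  proof (induction b)
    case (Suc b)
    have "mcost A i b < mcost A i (Suc b)" using A that(1) Suc.prems by (auto simp: arctic_auction_def)
    with Suc show ?case by (cases "a = b") auto
  qed simp
  have Y0: "0 \<le> Y i" if "i < goods A" for i
    using v[OF that] Y[OF that] by (auto intro!: sum_nonneg)
  have Ycap: "Y i \<le> supply_cap A i" if "i < goods A" for i
    using v[OF that] Y[OF that] by (auto simp: supply_cap_def cum_supply_def intro!: sum_mono)
  define profit where "profit = (\<lambda>i y. \<Sum>k<steps A i. (p i - mcost A i k) * fill A i y k)"
  have cost: "ereal (\<Sum>i<goods A. p i * z i) - cost A z = ereal (\<Sum>i<goods A. profit i (z i))"
    if z: "\<forall>i<goods A. 0 \<le> z i \<and> z i \<le> supply_cap A i" for z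
  proof -
    have "cost A z = (\<Sum>i<goods A. ereal (\<Sum>k<steps A i. mcost A i k * fill A i (z i) k))"
      unfolding cost_def using z K w by (intro sum.cong good_cost_fill) auto
    moreover have "p i * z i = (\<Sum>k<steps A i. p i * fill A i (z i) k)" if "i < goods A" for i
      unfolding sum_distrib_left[symmetric]
      using z w that sum_fill[of "steps A i" A i "z i"] by (simp add: supply_cap_def less_imp_le)
    ultimately show ?thesis
      by (simp add: profit_def sum_subtractf[symmetric] left_diff_distrib)
  qed
  \<comment> \<open>Marginal costs increase strictly, so the steps cheaper than \<open>p i\<close>
    form an initial segment that \<open>Y i\<close> covers, and \<open>Y i\<close> does not reach
    the dearer ones. At marginal cost exactly \<open>p i\<close> both sides are 0, whatever the
    quantity.\<close>
  have fillY: "(p i - mcost A i k) * fill A i (Y i) k = max 0 (p i - mcost A i k) * width A i k"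
    if i: "i < goods A" and k: "k < steps A i" for i k
  proof -
    have up: "Y i \<ge> cum_supply A i (Suc k)" if "mcost A i k < p i"
    proof -
      have "v i h = width A i h" if "h \<le> k" for h
        using full[OF i, of h] inc[OF i, of h k] \<open>mcost A i k < p i\<close> that k by (cases "h = k") auto
      then have "cum_supply A i (Suc k) = (\<Sum>h<Suc k. v i h)"
        by (simp add: cum_supply_def)
      also have "\<dots> \<le> Y i"
        unfolding Y[OF i] using v[OF i] k by (intro sum_mono2) auto
      finally show ?thesis .
    qed
    have down: "Y i \<le> cum_supply A i k" if "p i < mcost A i k"
    proof -
      have "v i h = 0" if "k \<le> h" "h < steps A i" for h
        using none[OF i, of h] inc[OF i, of k h] \<open>p i < mcost A i k\<close> that by (cases "h = k") auto
      then have "Y i = (\<Sum>h<k. v i h)"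
        unfolding Y[OF i] using k by (intro sum.mono_neutral_right) (auto simp: not_less)
      also have "\<dots> \<le> cum_supply A i k"
        unfolding cum_supply_def using v[OF i] k by (intro sum_mono) auto
      finally show ?thesis .
    qed
    show ?thesis
      using up down w[OF i k] by (cases "mcost A i k" "p i" rule: linorder_cases) (auto simp: fill_def)
  qed
  have le: "profit i y \<le> profit i (Y i)" if i: "i < goods A" for i y
    unfolding profit_def
  proof (rule sum_mono)
    fix k assume "k \<in> {..<steps A i}"
    then have k: "k < steps A i" by simp
    have "(p i - mcost A i k) * fill A i y k \<le> max 0 (p i - mcost A i k) * fill A i y k"
      by (intro mult_right_mono) (auto simp: fill_def)
    also have "\<dots> \<le> max 0 (p i - mcost A i k) * width A i k"
      using w[OF i k] by (intro mult_left_mono) (auto simp: fill_def)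
    finally show "(p i - mcost A i k) * fill A i y k \<le> (p i - mcost A i k) * fill A i (Y i) k"
      using fillY[OF i k] by simp
  qed
  have "ereal (\<Sum>i<goods A. p i * z i) - cost A z \<le> ereal (\<Sum>i<goods A. p i * Y i) - cost A Y"
    if z: "\<forall>i<goods A. 0 \<le> z i" for z
  proof (cases "\<forall>i<goods A. z i \<le> supply_cap A i")
    case True
    then have "ereal (\<Sum>i<goods A. p i * z i) - cost A z = ereal (\<Sum>i<goods A. profit i (z i))"
      using z by (intro cost) auto
    also have "\<dots> \<le> ereal (\<Sum>i<goods A. profit i (Y i))"
      by (auto intro!: sum_mono le)
    also have "\<dots> = ereal (\<Sum>i<goods A. p i * Y i) - cost A Y"
      using Y0 Ycap by (intro cost[symmetric]) auto
    finally show ?thesis .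
  next
    case False
    then obtain h where h: "h < goods A" "supply_cap A h < z h" by (auto simp: not_le)
    then have "good_cost A h (z h) = \<infinity>" by (simp add: good_cost_above)
    then have "cost A z = \<infinity>"
      unfolding cost_def using h(1) by (subst sum_Pinfty) auto
    then show ?thesis by simp
  qed
  then show ?thesis using Y0 by (simp add: is_arg_max_linorder)
qed

section \<open>Supply and existence of equilibria in costless auctions\<close>

lemma cost_costless:
  assumes "costless B" "\<forall>i<goods B. 0 \<le> z i"
  shows "cost B z = (if \<forall>i<goods B. z i \<le> supply_cap B i then 0 else \<infinity>)"
proof (cases "\<forall>i<goods B. z i \<le> supply_cap B i")
  case True
  then show ?thesis using assms by (simp add: cost_def costless_def)
next
  case False
  then obtain h where h: "h < goods B" "supply_cap B h < z h" by (auto simp: not_le)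
  then have "good_cost B h (z h) = \<infinity>" by (simp add: good_cost_above)
  then have "cost B z = \<infinity>"
    unfolding cost_def using h(1) by (subst sum_Pinfty) auto
  then show ?thesis using False by simp
qed

text \<open>At positive prices the full supply is the only optimum, so the condition on the
  auctioneer is market clearing. Existence uses the direction from clearing to optimality, the
  recovery of equilibria the converse.\<close>

lemma seller_costless:
  assumes B: "costless B" and cap: "\<And>i. i < goods B \<Longrightarrow> 0 \<le> supply_cap B i"
    and p: "\<And>i. i < goods B \<Longrightarrow> 0 < p i"
  shows "is_arg_max (\<lambda>z. ereal (\<Sum>i<goods B. p i * z i) - cost B z) (\<lambda>z. \<forall>i<goods B. 0 \<le> z i) Y
    \<longleftrightarrow> (\<forall>i<goods B. Y i = supply_cap B i)" (is "?opt \<longleftrightarrow> ?sold")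
proof
  assume opt: ?opt
  then have Y0: "\<forall>i<goods B. 0 \<le> Y i" by (simp add: is_arg_max_linorder)
  have le: "ereal (\<Sum>i<goods B. p i * supply_cap B i) \<le> ereal (\<Sum>i<goods B. p i * Y i) - cost B Y"
  proof -
    have "ereal (\<Sum>i<goods B. p i * supply_cap B i) - cost B (supply_cap B)
        \<le> ereal (\<Sum>i<goods B. p i * Y i) - cost B Y"
      using opt cap unfolding is_arg_max_linorder by blast
    then show ?thesis using cap cost_costless[OF B, of "supply_cap B"] by simp
  qed
  then have Ycap: "\<forall>i<goods B. Y i \<le> supply_cap B i"
    using cost_costless[OF B Y0] by (auto split: if_splits)
  then have "(\<Sum>i<goods B. p i * supply_cap B i) \<le> (\<Sum>i<goods B. p i * Y i)"
    using le cost_costless[OF B Y0] by simp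
  then have "(\<Sum>i<goods B. p i * (supply_cap B i - Y i)) \<le> 0"
    by (simp add: right_diff_distrib sum_subtractf)
  moreover have nn: "0 \<le> p i * (supply_cap B i - Y i)" if "i < goods B" for i
    using p[OF that] Ycap that by simp
  ultimately have "(\<Sum>i<goods B. p i * (supply_cap B i - Y i)) = 0"
    by (intro antisym sum_nonneg) auto
  then have "p i * (supply_cap B i - Y i) = 0" if "i < goods B" for i
    using nn that by (subst (asm) sum_nonneg_eq_0_iff) auto
  then show ?sold using p by force
next
  assume sold: ?sold
  have "ereal (\<Sum>i<goods B. p i * z i) - cost B z \<le> ereal (\<Sum>i<goods B. p i * Y i) - cost B Y"
    if z: "\<forall>i<goods B. 0 \<le> z i" for z
  proof (cases "\<forall>i<goods B. z i \<le> supply_cap B i")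
    case True
    have "(\<Sum>i<goods B. p i * z i) \<le> (\<Sum>i<goods B. p i * Y i)"
      using True sold p by (intro sum_mono mult_left_mono) (auto simp: less_imp_le)
    moreover have "cost B z = 0" "cost B Y = 0"
      using True sold cap z by (auto simp: cost_costless[OF B])
    ultimately show ?thesis by simp
  next
    case False
    then have "cost B z = \<infinity>" using z by (simp add: cost_costless[OF B])
    then show ?thesis by simp
  qed
  then show ?opt using sold cap by (simp add: is_arg_max_linorder)
qed

theorem costless_equilibrium_exists:
  assumes B: "arctic_auction B" "costless B"
  shows "\<exists>p x. competitive_equilibrium B p x"
proof -
  have cap: "0 \<le> supply_cap B i" if "i < goods B" for i
    unfolding supply_cap_def cum_supply_def using B(1) that
    by (intro sum_nonneg) (auto simp: arctic_auction_def less_imp_le)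
  obtain p x where p: "\<And>i. i < goods B \<Longrightarrow> 0 < p i"
    and x: "\<And>i j. i < goods B \<Longrightarrow> j < bids B \<Longrightarrow> 0 \<le> x j i"
    and sold: "\<And>i. i < goods B \<Longrightarrow> (\<Sum>j<bids B. x j i) = supply_cap B i"
    and bud: "\<And>j. j < bids B \<Longrightarrow> (\<Sum>i<goods B. p i * x j i) \<le> budget B j"
    and best: "\<And>j z. j < bids B \<Longrightarrow> (\<And>i. i < goods B \<Longrightarrow> 0 \<le> z i) \<Longrightarrow>
       (\<Sum>i<goods B. p i * z i) \<le> budget B j \<Longrightarrow>
      (\<Sum>i<goods B. (val B j i - p i) * z i) \<le> (\<Sum>i<goods B. (val B j i - p i) * x j i)"
  proof (rule linear_market_equilibrium[of "bids B" "budget B" "goods B" "val B" "supply_cap B"])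
    show "0 \<le> budget B j" if "j < bids B" for j
      using B(1) that by (simp add: arctic_auction_def)
    show "0 \<le> val B j i" if "i < goods B" "j < bids B" for i j
      using B(1) that by (simp add: arctic_auction_def)
    show "\<exists>j<bids B. 0 < budget B j \<and> 0 < val B j i" if "i < goods B" for i
      using B(1) that by (simp add: arctic_auction_def)
  qed (use cap in blast)+
  have "competitive_equilibrium B p x"
    unfolding competitive_equilibrium_def
    using p x sold bud best seller_costless[OF B(2) cap p] by (auto simp: demand_iff)
  then show ?thesis by blast
qed

section \<open>The reduced auction\<close>

definition offset :: "auction \<Rightarrow> nat \<Rightarrow> nat" where
  "offset A i = (\<Sum>h<i. steps A h)"

definition total_steps :: "auction \<Rightarrow> nat" where
  "total_steps A = offset A (goods A)"

definition good_of :: "auction \<Rightarrow> nat \<Rightarrow> nat" where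
  "good_of A g = (LEAST i. g < offset A (Suc i))"

definition step_of :: "auction \<Rightarrow> nat \<Rightarrow> nat" where
  "step_of A g = g - offset A (good_of A g)"

lemma offset_0 [simp]: "offset A 0 = 0"
  by (simp add: offset_def)

lemma offset_Suc [simp]: "offset A (Suc i) = offset A i + steps A i"
  by (simp add: offset_def)

lemma offset_mono: "i \<le> j \<Longrightarrow> offset A i \<le> offset A j"
  unfolding offset_def by (intro sum_mono2) auto

lemma good_of_offset [simp]:
  assumes "k < steps A i"
  shows "good_of A (offset A i + k) = i"
  unfolding good_of_def
proof (rule Least_equality)
  show "offset A i + k < offset A (Suc i)" using assms by simp
  fix h assume "offset A i + k < offset A (Suc h)"
  then show "i \<le> h" using offset_mono[of "Suc h" i A] by (meson leI le_add1 not_less order.trans Suc_leI)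
qed

lemma step_of_offset [simp]: "k < steps A i \<Longrightarrow> step_of A (offset A i + k) = k"
  by (simp add: step_of_def)

lemma offset_less_total:
  assumes "i < goods A" "k < steps A i"
  shows "offset A i + k < total_steps A"
  using offset_mono[of "Suc i" "goods A" A] assms by (simp add: total_steps_def)

lemma less_total_stepsE:
  assumes "g < total_steps A"
  obtains i k where "i < goods A" "k < steps A i" "g = offset A i + k"
proof -
  have "\<exists>i<n. \<exists>k<steps A i. g = offset A i + k" if "g < offset A n" for n
    using that
  proof (induction n)
    case (Suc n)
    show ?case
    proof (cases "g < offset A n")
      case True
      then show ?thesis using Suc.IH less_Suc_eq by blast
    next
      case False
      then have "g - offset A n < steps A n" "g = offset A n + (g - offset A n)"
        using Suc.prems by auto
      then show ?thesis by blast
    qed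
  qed simp
  then show ?thesis using assms that unfolding total_steps_def by blast
qed

lemma sum_offset: "(\<Sum>g<offset A n. f g) = (\<Sum>i<n. \<Sum>k<steps A i. f (offset A i + k))"
proof (induction n)
  case (Suc n)
  have "(\<Sum>g<a + b. f g) = (\<Sum>g<a. f g) + (\<Sum>k<b. f (a + k))" for a b
    by (induction b) (auto simp: add.assoc)
  with Suc show ?case by simp
qed simp

text \<open>
  Good \<open>offset A i + k\<close> of the reduced auction is step \<open>k\<close> of good \<open>i\<close>. Bid \<open>bids A + g\<close> plays the
  role of the cost of that step: below the price \<open>mcost A i k\<close> it would demand more than the whole
  supply, above it nothing. At marginal cost 0 any positive value will do, the budget being 0.
\<close>

definition step_cost :: "auction \<Rightarrow> nat \<Rightarrow> real" where
  "step_cost A g = mcost A (good_of A g) (step_of A g)"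

definition step_width :: "auction \<Rightarrow> nat \<Rightarrow> real" where
  "step_width A g = width A (good_of A g) (step_of A g)"

definition reduced_val :: "auction \<Rightarrow> nat \<Rightarrow> nat \<Rightarrow> real" where
  "reduced_val A b g =
     (if b < bids A then val A b (good_of A g)
      else if b = bids A + g then if 0 < step_cost A g then step_cost A g else 1
      else 0)"

text \<open>Entries out of range are 0 because the program must produce this auction as an exact
  value: \<open>read_auction\<close> returns whole arrays, and output cells that are never written
  hold 0.\<close>

definition reduced :: "auction \<Rightarrow> auction" where
  "reduced A =
     \<lparr>goods = total_steps A,
      bids = bids A + total_steps A,
      budget = (\<lambda>b. if b < bids A then budget A b
                    else if b < bids A + total_steps A
                    then step_cost A (b - bids A) * step_width A (b - bids A) else 0),
      val = (\<lambda>b g. if g < total_steps A then reduced_val A b g else 0),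
      steps = (\<lambda>g. if g < total_steps A then 1 else 0),
      width = (\<lambda>g k. if g < total_steps A \<and> k = 0 then step_width A g else 0),
      mcost = (\<lambda>g k. 0)\<rparr>"

text \<open>The zeros out of range again match output cells that are never written.\<close>

definition recover ::
  "auction \<times> (nat \<Rightarrow> real) \<times> (nat \<Rightarrow> nat \<Rightarrow> real) \<Rightarrow> (nat \<Rightarrow> real) \<times> (nat \<Rightarrow> nat \<Rightarrow> real)" where
  "recover = (\<lambda>(A, p, x).
     (\<lambda>i. if i < goods A then Min ((\<lambda>k. p (offset A i + k)) ` {..<steps A i}) else 0,
      \<lambda>j i. if j < bids A \<and> i < goods A then \<Sum>k<steps A i. x j (offset A i + k) else 0))"

lemma reduced_simps [simp]:
  "goods (reduced A) = total_steps A"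
  "bids (reduced A) = bids A + total_steps A"
  "b < bids A \<Longrightarrow> budget (reduced A) b = budget A b"
  "g < total_steps A \<Longrightarrow> budget (reduced A) (bids A + g) = step_cost A g * step_width A g"
  "g < total_steps A \<Longrightarrow> val (reduced A) b g = reduced_val A b g"
  "g < total_steps A \<Longrightarrow> supply_cap (reduced A) g = step_width A g"
  "mcost (reduced A) g k = 0"
  by (simp_all add: reduced_def supply_cap_def cum_supply_def)

lemma step_offset [simp]:
  assumes "k < steps A i"
  shows "step_cost A (offset A i + k) = mcost A i k"
    and "step_width A (offset A i + k) = width A i k"
    and "b < bids A \<Longrightarrow> reduced_val A b (offset A i + k) = val A b i"
  using assms by (simp_all add: step_cost_def step_width_def reduced_val_def)

lemma mcost_nonneg:
  assumes A: "arctic_auction A" and i: "i < goods A" and k: "k < steps A i"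
  shows "0 \<le> mcost A i k"
  using k
proof (induction k)
  case 0
  then show ?case using A i by (simp add: arctic_auction_def)
next
  case (Suc k)
  then have "mcost A i k < mcost A i (Suc k)" using A i by (simp add: arctic_auction_def)
  with Suc show ?case by simp
qed

lemma step_pos:
  assumes "arctic_auction A" "g < total_steps A"
  shows "0 \<le> step_cost A g" "0 < step_width A g"
  using assms mcost_nonneg[OF assms(1)] by (auto elim!: less_total_stepsE simp: arctic_auction_def)

section \<open>The reduced auction is a costless Arctic auction\<close>

lemma costless_reduced: "costless (reduced A)"
proof -
  have "good_cost (reduced A) g y = 0" if g: "g < total_steps A" and y: "y \<le> step_width A g" for g y
  proof -
    have "cum_supply (reduced A) g (Suc 0) = step_width A g"
      using g by (simp add: cum_supply_def reduced_def)
    then have "(LEAST l. y \<le> cum_supply (reduced A) g (Suc l)) = 0"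
      using y by (intro Least_eq_0) simp
    then show ?thesis
      using g y by (simp add: good_cost_def)
  qed
  then show ?thesis by (auto simp: costless_def good_cost_above)
qed

text \<open>A bid with positive budget for a step is inherited from the original auction, as the
  additional bid has budget 0 when the marginal cost is 0. The additional bid still needs a valued
  good, which the value 1 supplies in that case.\<close>

lemma arctic_reduced:
  assumes A: "arctic_auction A"
  shows "arctic_auction (reduced A)"
proof -
  let ?N = "total_steps A"
  have nonneg: "0 \<le> budget (reduced A) b \<and> (\<forall>g<?N. 0 \<le> val (reduced A) b g)"
    and some: "\<exists>g<?N. 0 < val (reduced A) b g" if b: "b < bids A + ?N" for b
  proof -
    have "0 \<le> budget (reduced A) b \<and> (\<forall>g<?N. 0 \<le> val (reduced A) b g) \<and> (\<exists>g<?N. 0 < val (reduced A) b g)"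
    proof (cases "b < bids A")
      case True
      then obtain i where i: "i < goods A" "0 < val A b i" using A by (auto simp: arctic_auction_def)
      then have k: "0 < steps A i" using A by (force simp: arctic_auction_def)
      have "0 \<le> val (reduced A) b g" if "g < ?N" for g
        using that A True by (auto elim!: less_total_stepsE simp: arctic_auction_def offset_less_total)
      moreover have "0 < val (reduced A) b (offset A i + 0)"
        using offset_less_total[OF i(1) k] step_offset(3)[OF k True] i by simp
      ultimately show ?thesis
        using A True offset_less_total[OF i(1) k] by (auto simp: arctic_auction_def)
    next
      case False
      then obtain g where g: "b = bids A + g" "g < ?N" using b by (metis add_less_cancel_left le_Suc_ex not_less)
      then have "0 \<le> budget (reduced A) b"
        using step_pos[OF A g(2)] by simp
      moreover have "0 < val (reduced A) b g" using g by (simp add: reduced_val_def)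
      ultimately show ?thesis
        using g step_pos[OF A] by (auto simp: reduced_val_def)
    qed
    then show "0 \<le> budget (reduced A) b \<and> (\<forall>g<?N. 0 \<le> val (reduced A) b g)"
      "\<exists>g<?N. 0 < val (reduced A) b g" by auto
  qed
  have dem: "\<exists>b<bids A + ?N. 0 < budget (reduced A) b \<and> 0 < val (reduced A) b g" if g: "g < ?N" for g
  proof -
    from g obtain i k where ik: "i < goods A" "k < steps A i" "g = offset A i + k"
      by (rule less_total_stepsE)
    obtain j where "j < bids A" "0 < budget A j" "0 < val A j i"
      using A ik(1) by (auto simp: arctic_auction_def)
    then show ?thesis using ik g by (intro exI[of _ j]) auto
  qed
  have "1 \<le> steps (reduced A) g \<and> (\<forall>k<steps (reduced A) g. 0 < width (reduced A) g k) \<and>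
      0 \<le> mcost (reduced A) g 0 \<and> (\<forall>k. Suc k < steps (reduced A) g \<longrightarrow> mcost (reduced A) g k < mcost (reduced A) g (Suc k))"
    if "g < ?N" for g
    using that step_pos(2)[OF A] by (simp add: reduced_def del: reduced_simps)
  with nonneg some dem show ?thesis
    unfolding arctic_auction_def by (simp only: reduced_simps(1,2)) blast
qed

section \<open>From an equilibrium of the reduced auction to one of the original\<close>

theorem recover_equilibrium:
  assumes A: "arctic_auction A" and ce: "competitive_equilibrium (reduced A) q x"
    and rec: "recover (A, q, x) = (p', x')"
  shows "competitive_equilibrium A p' x'"
proof -
  let ?N = "total_steps A" and ?o = "offset A"
  have q: "0 < q g" if "g < ?N" for g
    using ce that by (simp add: competitive_equilibrium_def)
  have dem: "x b \<in> demand (reduced A) q b" if "b < bids A + ?N" for b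
    using ce that by (simp add: competitive_equilibrium_def)
  have x0: "0 \<le> x b g" if "b < bids A + ?N" "g < ?N" for b g
    using dem[OF that(1)] that(2) by (simp add: demand_iff)
  note dem_facts =
    demand_val_ge_price[OF dem, unfolded reduced_simps, OF _ q]
    demand_best_ratio[OF dem, unfolded reduced_simps, OF _ q]
    demand_budget_spent[OF dem, unfolded reduced_simps, OF _ q]
    demand_zero_budget[OF dem, unfolded reduced_simps, OF _ q]
  have sold: "(\<Sum>b<bids A + ?N. x b g) = step_width A g" if "g < ?N" for g
    using seller_costless[OF costless_reduced, of A q "\<lambda>g. \<Sum>b<bids A + ?N. x b g"]
      ce q step_pos(2)[OF A] that by (simp add: competitive_equilibrium_def less_imp_le)
  have aux_other: "x (bids A + g) h = 0" if "g < ?N" "h < ?N" "h \<noteq> g" for g h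
  proof (rule ccontr)
    assume "x (bids A + g) h \<noteq> 0"
    then have "0 < x (bids A + g) h" using x0[of "bids A + g" h] that by force
    then have "q h \<le> reduced_val A (bids A + g) h"
      using dem_facts(1)[of "bids A + g" h] that by simp
    then show False using q[OF that(2)] that by (simp add: reduced_val_def)
  qed
  have cost_le: "step_cost A g \<le> q g" if g: "g < ?N" for g
  proof (rule ccontr)
    assume less: "\<not> ?thesis"
    have val: "reduced_val A (bids A + g) g = step_cost A g"
      using less q[OF g] by (simp add: reduced_val_def)
    have "(\<Sum>h<?N. q h * x (bids A + g) h) = step_cost A g * step_width A g"
      using dem_facts(3)[of "bids A + g" g] less g by (simp add: val)
    also have "(\<Sum>h<?N. q h * x (bids A + g) h) = (\<Sum>h<?N. if h = g then q g * x (bids A + g) g else 0)"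
      using aux_other[OF g] by (intro sum.cong) auto
    also have "\<dots> = q g * x (bids A + g) g" using g by simp
    finally have spent: "q g * x (bids A + g) g = step_cost A g * step_width A g" .
    have "x (bids A + g) g \<le> (\<Sum>b<bids A + ?N. x b g)"
      using g x0 by (intro member_le_sum) auto
    then have "x (bids A + g) g \<le> step_width A g" using sold[OF g] by simp
    then have "q g * x (bids A + g) g \<le> q g * step_width A g"
      using q[OF g] by simp
    also have "\<dots> < step_cost A g * step_width A g"
      using less step_pos(2)[OF A g] by simp
    finally show False using spent by simp
  qed
  \<comment> \<open>At marginal cost 0 the value 1 may well exceed the price; there it is the zero
    budget that prevents a purchase.\<close>
  have aux_zero: "x (bids A + g) g = 0" if g: "g < ?N" and less: "step_cost A g < q g" for g
  proof (cases "step_cost A g = 0")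
    case True
    then show ?thesis using dem_facts(4)[of "bids A + g" g] g by simp
  next
    case False
    then have "reduced_val A (bids A + g) g = step_cost A g"
      using step_pos(1)[OF A g] by (simp add: reduced_val_def)
    then show ?thesis
      using dem_facts(1)[of "bids A + g" g] g less x0[of "bids A + g" g] by force
  qed
  have split: "step_width A g = (\<Sum>j<bids A. x j g) + x (bids A + g) g" if g: "g < ?N" for g
  proof -
    have eq: "(\<Sum>b<a + c. f b) = (\<Sum>b<a. f b) + (\<Sum>k<c. f (a + k))" for a c and f :: "nat \<Rightarrow> real"
      by (induction c) (auto simp: add.assoc)
    have "(\<Sum>h<?N. x (bids A + h) g) = (\<Sum>h<?N. if h = g then x (bids A + g) g else 0)"
      using aux_other[of _ g] g by (intro sum.cong) auto
    then show ?thesis using sold[OF g] g by (simp add: eq)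
  qed

  have K: "1 \<le> steps A i" if "i < goods A" for i using A that by (simp add: arctic_auction_def)
  define p where "p = (\<lambda>i. Min ((\<lambda>k. q (?o i + k)) ` {..<steps A i}))"
  have p': "p' = (\<lambda>i. if i < goods A then p i else 0)"
    and x': "x' = (\<lambda>j i. if j < bids A \<and> i < goods A then \<Sum>k<steps A i. x j (?o i + k) else 0)"
    using rec by (auto simp: recover_def p_def)
  have p_le: "p i \<le> q (?o i + k)" if "i < goods A" "k < steps A i" for i k
    using that by (simp add: p_def)
  have "\<exists>k<steps A i. p i = q (?o i + k)" if "i < goods A" for i
  proof -
    have "p i \<in> (\<lambda>k. q (?o i + k)) ` {..<steps A i}"
      unfolding p_def using K[OF that] by (intro Min_in) (auto simp: lessThan_empty_iff)
    then show ?thesis by auto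
  qed
  then obtain kmin where kmin: "\<And>i. i < goods A \<Longrightarrow> kmin i < steps A i"
    and pk: "\<And>i. i < goods A \<Longrightarrow> p i = q (?o i + kmin i)" by metis
  have p0: "0 < p i" if "i < goods A" for i
    using pk[OF that] q offset_less_total[OF that kmin[OF that]] by simp
  \<comment> \<open>A bid values all steps of a good equally, so the best-ratio condition compares
    prices alone; the common value is at least a positive price and can be cancelled.\<close>
  have cheapest: "q (?o i + k) = p i"
    if i: "i < goods A" and k: "k < steps A i" and j: "j < bids A" and pos: "0 < x j (?o i + k)" for i j k
  proof -
    note o = offset_less_total[OF i k] offset_less_total[OF i kmin[OF i]]
    have "q (?o i + k) \<le> val A j i"
      using dem_facts(1)[of j "?o i + k"] o k j pos by simp
    moreover have "val A j i * q (?o i + k) \<le> val A j i * p i"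
      using dem_facts(2)[of j "?o i + k" "?o i + kmin i"] o k kmin[OF i] j pos pk[OF i] by simp
    ultimately have "q (?o i + k) \<le> p i"
      using q[OF o(1)] by (simp add: mult_le_cancel_left)
    then show ?thesis using p_le[OF i k] by simp
  qed
  define v where "v = (\<lambda>i k. \<Sum>j<bids A. x j (?o i + k))"
  have v0: "0 \<le> v i k" if "i < goods A" "k < steps A i" for i k
    unfolding v_def using x0 offset_less_total[OF that] by (intro sum_nonneg) auto
  have v_aux: "width A i k = v i k + x (bids A + (?o i + k)) (?o i + k)" if "i < goods A" "k < steps A i" for i k
    using split[OF offset_less_total[OF that]] that by (simp add: v_def)
  have seller: "is_arg_max (\<lambda>z. ereal (\<Sum>i<goods A. p i * z i) - cost A z) (\<lambda>z. \<forall>i<goods A. 0 \<le> z i)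
      (\<lambda>i. \<Sum>k<steps A i. v i k)"
  proof (rule seller_optimal[OF A, where v = v])
    fix i k assume i: "i < goods A" and k: "k < steps A i"
    note o = offset_less_total[OF i k]
    show "0 \<le> v i k \<and> v i k \<le> width A i k"
      using v0[OF i k] v_aux[OF i k] x0[of "bids A + (?o i + k)" "?o i + k"] o by simp
    show "v i k = width A i k" if "mcost A i k < p i"
      using aux_zero[OF o] that p_le[OF i k] k v_aux[OF i k] by simp
    \<comment> \<open>The price of such a step is at least its marginal cost, hence strictly above
      the least step price, and no original bid buys it.\<close>
    show "v i k = 0" if "p i < mcost A i k"
    proof -
      have "p i < q (?o i + k)" using cost_le[OF o] k that by simp
      then have "\<not> 0 < x j (?o i + k)" if "j < bids A" for j
        using cheapest[OF i k that] by auto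
      then show ?thesis unfolding v_def using x0[OF _ o]
        by (intro sum.neutral) (metis lessThan_iff order_le_less trans_less_add1)
    qed
  qed simp
  have "x' j \<in> demand A p' j" if j: "j < bids A" for j
  proof -
    have J: "j < bids A + ?N" using j by simp
    let ?x = "\<lambda>i. \<Sum>k<steps A i. x j (?o i + k)"
    have hat: "(\<Sum>g<?N. q g * x j g) \<le> budget A j"
      and opt: "\<And>z. (\<forall>g<?N. 0 \<le> z g) \<Longrightarrow> (\<Sum>g<?N. q g * z g) \<le> budget A j \<Longrightarrow>
        (\<Sum>g<?N. (reduced_val A j g - q g) * z g) \<le> (\<Sum>g<?N. (reduced_val A j g - q g) * x j g)"
      using dem[OF J] j by (simp_all add: demand_iff)
    have xj0: "0 \<le> x j (?o i + k)" if "i < goods A" "k < steps A i" for i k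
      using x0[OF J offset_less_total[OF that]] .
    have nonneg: "\<forall>i<goods A. 0 \<le> ?x i" using xj0 by (auto intro!: sum_nonneg)
    have "(\<Sum>i<goods A. p i * ?x i) \<le> (\<Sum>g<?N. q g * x j g)"
      unfolding total_steps_def sum_offset sum_distrib_left
      using p_le xj0 by (intro sum_mono mult_right_mono) auto
    then have bud: "(\<Sum>i<goods A. p i * ?x i) \<le> budget A j" using hat by simp
    have "(\<Sum>i<goods A. (val A j i - p i) * z i) \<le> (\<Sum>i<goods A. (val A j i - p i) * ?x i)"
      if z: "\<forall>i<goods A. 0 \<le> z i" "(\<Sum>i<goods A. p i * z i) \<le> budget A j" for z
    proof -
      \<comment> \<open>An arbitrary bundle \<open>z\<close> of the original goods, bought at the
        cheapest step of each good: expenditure and net value are the same in both auctions. Widths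
        do not restrict it, since demand ignores supply.\<close>
      define zh where "zh = (\<lambda>g. if step_of A g = kmin (good_of A g) then z (good_of A g) else 0)"
      have zh: "(\<Sum>g<?N. c g * zh g) = (\<Sum>i<goods A. c (?o i + kmin i) * z i)" for c
      proof -
        have "(\<Sum>k<steps A i. c (?o i + k) * zh (?o i + k)) = c (?o i + kmin i) * z i" if "i < goods A" for i
        proof -
          have "(\<Sum>k<steps A i. c (?o i + k) * zh (?o i + k)) =
              (\<Sum>k<steps A i. if k = kmin i then c (?o i + kmin i) * z i else 0)"
            by (intro sum.cong) (auto simp: zh_def)
          then show ?thesis using kmin[OF that] by simp
        qed
        then show ?thesis unfolding total_steps_def sum_offset by simp
      qed
      have "(\<Sum>i<goods A. (val A j i - p i) * z i) = (\<Sum>g<?N. (reduced_val A j g - q g) * zh g)"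
        using pk kmin j by (simp add: zh)
      also have "\<dots> \<le> (\<Sum>g<?N. (reduced_val A j g - q g) * x j g)"
      proof (rule opt)
        show "\<forall>g<?N. 0 \<le> zh g" using z(1) by (auto simp: zh_def elim!: less_total_stepsE)
        show "(\<Sum>g<?N. q g * zh g) \<le> budget A j" using z(2) pk by (simp add: zh)
      qed
      \<comment> \<open>Charging the least step price instead of the actual one can only increase
        the net value.\<close>
      also have "\<dots> \<le> (\<Sum>i<goods A. (val A j i - p i) * ?x i)"
        unfolding total_steps_def sum_offset sum_distrib_left
        using p_le xj0 j by (intro sum_mono mult_right_mono) auto
      finally show ?thesis .
    qed
    then show ?thesis using nonneg bud j by (simp add: demand_iff p' x')
  qed
  moreover have "\<forall>i<goods A. 0 < p' i" using p0 by (simp add: p')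
  moreover have "is_arg_max (\<lambda>z. ereal (\<Sum>i<goods A. p' i * z i) - cost A z) (\<lambda>z. \<forall>i<goods A. 0 \<le> z i)
      (\<lambda>i. \<Sum>j<bids A. x' j i)"
  proof -
    have eq: "(\<Sum>j<bids A. x' j i) = (\<Sum>k<steps A i. v i k)" if "i < goods A" for i
      using that by (simp add: x' v_def sum.swap[of _ "{..<bids A}"])
    have "cost A (\<lambda>i. \<Sum>j<bids A. x' j i) = cost A (\<lambda>i. \<Sum>k<steps A i. v i k)"
      by (simp add: cost_def eq)
    then show ?thesis using seller by (simp add: is_arg_max_linorder p' eq)
  qed
  ultimately show ?thesis by (simp add: competitive_equilibrium_def)
qed

section \<open>Encoding lengths\<close>

text \<open>
  Unlike \<open>rat_len\<close>, the sum of the absolute values of numerator and denominator is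
  submultiplicative under both addition and multiplication.
\<close>

definition rat_size :: "rat \<Rightarrow> nat" where
  "rat_size q = nat \<bar>fst (quotient_of q)\<bar> + nat (snd (quotient_of q))"

lemma normalize_bounds:
  assumes "0 < b"
  shows "\<bar>fst (Rat.normalize (a, b))\<bar> \<le> \<bar>a\<bar> \<and> snd (Rat.normalize (a, b)) \<le> b"
proof -
  have g: "1 \<le> gcd a b" using assms by (simp add: int_one_le_iff_zero_less)
  have le: "\<bar>x div gcd a b\<bar> \<le> \<bar>x\<bar>" if dvd: "gcd a b dvd x" for x
  proof -
    obtain k where "x = gcd a b * k" using dvd by (rule dvdE)
    then show ?thesis using g by (auto simp: abs_mult mult_le_cancel_right1)
  qed
  have "\<bar>a div gcd a b\<bar> \<le> \<bar>a\<bar>" "b div gcd a b \<le> b"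
    using le[of a] le[of b] assms by auto
  then show ?thesis using assms by (simp add: Rat.normalize_def Let_def)
qed

lemma rat_size_normalize:
  assumes "quotient_of q = Rat.normalize (a, b)" "0 < b" "nat \<bar>a\<bar> + nat b \<le> n"
  shows "rat_size q \<le> n"
proof -
  have "nat \<bar>fst (Rat.normalize (a, b))\<bar> \<le> nat \<bar>a\<bar>" "nat (snd (Rat.normalize (a, b))) \<le> nat b"
    using normalize_bounds[OF assms(2), of a] by (auto intro: nat_mono)
  with assms(3) show ?thesis unfolding rat_size_def assms(1) by linarith
qed

text \<open>The four products in \<open>(\<bar>a\<bar> + c) * (\<bar>b\<bar> + d)\<close> dominate
  numerator plus denominator of the unreduced sum and product, and cancelling the gcd only shrinks
  both.\<close>

lemma rat_size_add_mult:
  "rat_size (x + y) \<le> rat_size x * rat_size y" "rat_size (x * y) \<le> rat_size x * rat_size y"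
proof -
  obtain a c where x: "quotient_of x = (a, c)" by fastforce
  obtain b d where y: "quotient_of y = (b, d)" by fastforce
  have pos: "0 < c" "0 < d"
    using quotient_of_denom_pos[OF x] quotient_of_denom_pos[OF y] by auto
  have prod: "rat_size x * rat_size y = nat ((\<bar>a\<bar> + c) * (\<bar>b\<bar> + d))"
    using x y pos by (simp add: rat_size_def nat_mult_distrib nat_add_distrib)
  have expand: "(\<bar>a\<bar> + c) * (\<bar>b\<bar> + d) = \<bar>a\<bar> * \<bar>b\<bar> + \<bar>a\<bar> * d + c * \<bar>b\<bar> + c * d"
    by (simp add: algebra_simps)
  have nn: "0 \<le> \<bar>a\<bar> * \<bar>b\<bar>" "0 \<le> \<bar>a\<bar> * d" "0 \<le> c * \<bar>b\<bar>" "0 < c * d"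
    using pos by auto
  have "\<bar>a * d + b * c\<bar> \<le> \<bar>a\<bar> * d + c * \<bar>b\<bar>"
    using abs_triangle_ineq[of "a * d" "b * c"] pos by (simp add: abs_mult mult.commute)
  then have "\<bar>a * d + b * c\<bar> + c * d \<le> (\<bar>a\<bar> + c) * (\<bar>b\<bar> + d)"
    unfolding expand using nn by linarith
  then have 1: "nat \<bar>a * d + b * c\<bar> + nat (c * d) \<le> nat ((\<bar>a\<bar> + c) * (\<bar>b\<bar> + d))"
    using nn(4) by (subst nat_add_distrib[symmetric]) (simp_all only: abs_ge_zero less_imp_le nat_mono)
  show "rat_size (x + y) \<le> rat_size x * rat_size y"
    unfolding prod by (rule rat_size_normalize[OF _ _ 1]) (use x y pos in \<open>auto simp: rat_plus_code\<close>)
  have 2: "nat \<bar>a * b\<bar> + nat (c * d) \<le> nat ((\<bar>a\<bar> + c) * (\<bar>b\<bar> + d))"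
    unfolding expand abs_mult using nn by (subst nat_add_distrib[symmetric]) (auto intro!: nat_mono)
  show "rat_size (x * y) \<le> rat_size x * rat_size y"
    unfolding prod by (rule rat_size_normalize[OF _ _ 2]) (use x y pos in \<open>auto simp: rat_times_code\<close>)
qed

lemma floorlog_le_self: "floorlog 2 n \<le> n"
  by (rule floorlog_leI) auto

lemma rat_size_le: "rat_size q \<le> 2 ^ rat_len q"
proof -
  obtain a b where q: "quotient_of q = (a, b)" by fastforce
  define x y where "x = floorlog 2 (nat \<bar>a\<bar>)" and "y = floorlog 2 (nat b)"
  have "nat \<bar>a\<bar> < 2 ^ x" "nat b < 2 ^ y"
    unfolding x_def y_def by (rule floorlog_leD[OF order_refl]; simp)+
  then have "nat \<bar>a\<bar> + nat b \<le> 2 ^ x * 1 + 1 * 2 ^ y"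
    unfolding mult_1 mult_1_right by (intro add_mono less_imp_le)
  also have "\<dots> \<le> 2 ^ x * 2 ^ y + 2 ^ x * (2 ^ y :: nat)"
    by (intro add_mono mult_mono) auto
  also have "\<dots> = 2 ^ (1 + x + y)" by (simp add: power_add)
  finally show ?thesis by (simp add: rat_size_def rat_len_def q x_def y_def)
qed

text \<open>Numerator and denominator take at most \<open>L + 1\<close> bits each, and
  \<open>rat_len\<close> adds 1.\<close>

lemma rat_len_le:
  assumes "rat_size q \<le> 2 ^ L"
  shows "rat_len q \<le> 2 * L + 3"
proof -
  obtain a b where q: "quotient_of q = (a, b)" by fastforce
  have "(2::nat) ^ L < 2 ^ Suc L" by simp
  moreover have "nat \<bar>a\<bar> + nat b \<le> 2 ^ L" using assms by (simp add: rat_size_def q)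
  ultimately have "nat \<bar>a\<bar> < 2 ^ Suc L" "nat b < 2 ^ Suc L" by linarith+
  then have "floorlog 2 (nat \<bar>a\<bar>) \<le> Suc L" "floorlog 2 (nat b) \<le> Suc L"
    by (auto intro!: floorlog_leI)
  then show ?thesis by (simp add: rat_len_def q)
qed

text \<open>A logarithmic bound whose exponents simply add under \<open>+\<close> and
  \<open>*\<close>. The factor 2 between \<open>rat_size\<close> and \<open>rat_len\<close> is thus
  paid once at the end, not once per operation.\<close>

definition sized :: "nat \<Rightarrow> real \<Rightarrow> bool" where
  "sized L x \<longleftrightarrow> (\<exists>q. x = real_of_rat q \<and> rat_size q \<le> 2 ^ L)"

lemma num_len_of_rat [simp]: "num_len (real_of_rat q) = rat_len q"
  by (simp add: num_len_def the_inv_f_f inj_def)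

lemma num_len_pos: "1 \<le> num_len x"
  by (simp add: num_len_def rat_len_def split: prod.split)

lemma sized_num_len: "x \<in> \<rat> \<Longrightarrow> sized (num_len x) x"
  by (auto simp: sized_def Rats_def rat_size_le)

lemma sizedD: "sized L x \<Longrightarrow> x \<in> \<rat> \<and> num_len x \<le> 2 * L + 3"
  using rat_len_le by (auto simp: sized_def)

lemma sized_mono: "sized L x \<Longrightarrow> L \<le> L' \<Longrightarrow> sized L' x"
  unfolding sized_def using power_increasing[of L L' "2::nat"] order.trans by fastforce

lemma sized_add_mult:
  assumes "sized K x" "sized L y"
  shows "sized (K + L) (x + y)" "sized (K + L) (x * y)"
proof -
  obtain p q where pq: "x = real_of_rat p" "y = real_of_rat q" "rat_size p \<le> 2 ^ K" "rat_size q \<le> 2 ^ L"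
    using assms by (auto simp: sized_def)
  then have le: "rat_size p * rat_size q \<le> 2 ^ (K + L)"
    unfolding power_add by (intro mult_le_mono)
  show "sized (K + L) (x + y)"
    unfolding sized_def using pq order.trans[OF rat_size_add_mult(1) le]
    by (intro exI[of _ "p + q"]) (simp add: of_rat_add)
  show "sized (K + L) (x * y)"
    unfolding sized_def using pq order.trans[OF rat_size_add_mult(2) le]
    by (intro exI[of _ "p * q"]) (simp add: of_rat_mult)
qed

lemma sized_0: "sized 0 0"
  by (auto simp: sized_def rat_size_def intro!: exI[of _ 0])

lemma sized_sum:
  fixes k :: nat
  assumes "\<And>h. h < k \<Longrightarrow> f h \<in> \<rat>"
  shows "sized (\<Sum>h<k. num_len (f h)) (\<Sum>h<k. f h)"
  using assms by (induction k) (auto intro!: sized_0 sized_add_mult sized_num_len)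

lemma num_len_0 [simp]: "num_len 0 = 2"
  using num_len_of_rat[of 0] by (simp add: rat_len_def floorlog_def)

lemma num_len_1 [simp]: "num_len 1 = 3"
  using num_len_of_rat[of 1] by (simp add: rat_len_def floorlog_def)

section \<open>Total correctness of programs\<close>

lemma ivar_put_idx [simp]: "ivar (put_idx a i n s) v = (if v = a \<and> i = 0 then n else ivar s v)"
  by (simp add: ivar_def put_idx_def)

lemma idx_put_idx [simp]: "idx (put_idx a i n s) b h = (if b = a \<and> h = i then n else idx s b h)"
  by (simp add: put_idx_def)

lemma num_put_idx [simp]: "num (put_idx a i n s) = num s"
  by (simp add: put_idx_def)

lemma idx_put_num [simp]: "idx (put_num u x s) = idx s"
  by (cases u) simp

lemma ivar_put_num [simp]: "ivar (put_num u x s) = ivar s"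
  by (simp add: ivar_def fun_eq_iff)

lemma num_put_num [simp]:
  "num (put_num (Cell a i j) x s) b h l =
     (if b = a \<and> h = ivar s i \<and> l = ivar s j then x else num s b h l)"
  by simp

declare put_num.simps [simp del]

text \<open>Bounds the number of operations if every loop runs at most \<open>d\<close> times.\<close>

fun ops :: "nat \<Rightarrow> prog \<Rightarrow> nat" where
  "ops d Skip = 0"
| "ops d (ISet v e) = 1"
| "ops d (IPut a i v) = 1"
| "ops d (NSet u e) = 1"
| "ops d (Seq c1 c2) = ops d c1 + ops d c2"
| "ops d (Cond b c1 c2) = 1 + ops d c1 + ops d c2"
| "ops d (Loop b c) = 1 + d * (1 + ops d c)"

text \<open>Every loop contributes a factor \<open>d\<close>, and the nesting depth is fixed by the
  program.\<close>

lemma ops_poly: "\<exists>P :: nat poly. \<forall>d. ops d c = poly P d"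
proof (induction c)
  case Skip
  then show ?case by (intro exI[of _ 0]) simp
next
  case (Seq c1 c2)
  then obtain P1 P2 :: "nat poly" where "\<forall>d. ops d c1 = poly P1 d" "\<forall>d. ops d c2 = poly P2 d" by blast
  then show ?case by (intro exI[of _ "P1 + P2"]) simp
next
  case (Cond b c1 c2)
  then obtain P1 P2 :: "nat poly" where "\<forall>d. ops d c1 = poly P1 d" "\<forall>d. ops d c2 = poly P2 d" by blast
  then show ?case by (intro exI[of _ "1 + P1 + P2"]) simp
next
  case (Loop b c)
  then obtain P :: "nat poly" where "\<forall>d. ops d c = poly P d" by blast
  then show ?case by (intro exI[of _ "1 + [:0, 1:] * (1 + P)"]) simp
qed (auto intro!: exI[of _ 1])

text \<open>Index addition takes variables only, so the increment relies on the variable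
  \<open>''one''\<close> holding 1.\<close>

definition for_loop :: "string \<Rightarrow> string \<Rightarrow> prog \<Rightarrow> prog" where
  "for_loop v u c = Seq (ISet v (IConst 0)) (Loop (ILess v u) (Seq c (ISet v (IAdd v ''one''))))"

text \<open>\<open>R\<close> says that the data are rational, \<open>B\<close> bounds the lengths of
  numbers and \<open>d\<close> the iterations of each loop. The bound 3 is the encoding length of 1,
  the constant that the forward program writes.\<close>

locale bounded_machine =
  fixes R :: bool and B d :: nat
  assumes B: "3 \<le> B"
begin

definition ok :: "state \<Rightarrow> bool" where
  "ok s \<longleftrightarrow> (R \<longrightarrow> numbers_bounded B s)"

text \<open>Termination, postcondition, operation count and boundedness of all visited states at
  once. Assuming \<open>ok\<close> of the initial state makes copying free of obligations: a copied
  number is already short.\<close>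

definition wp :: "prog \<Rightarrow> (state \<Rightarrow> bool) \<Rightarrow> state \<Rightarrow> bool" where
  "wp c Q s \<longleftrightarrow> (ok s \<longrightarrow> (\<exists>tr s'. exec c s tr s' \<and> ok s' \<and> Q s' \<and>
     length tr \<le> ops d c \<and> (\<forall>u\<in>set tr. ok u)))"

lemma wp_skip: "Q s \<Longrightarrow> wp Skip Q s"
  unfolding wp_def by (intro impI exI[of _ "[]"] exI[of _ s]) (auto intro: exec.Skip)

lemma ok_put_idx: "ok s \<Longrightarrow> floorlog 2 n \<le> B \<Longrightarrow> ok (put_idx a i n s)"
  by (auto simp: ok_def numbers_bounded_def)

lemma ok_put_num: "ok s \<Longrightarrow> (R \<longrightarrow> x \<in> \<rat> \<and> num_len x \<le> B) \<Longrightarrow> ok (put_num u x s)"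
  by (cases u) (auto simp: ok_def numbers_bounded_def)

text \<open>The index value itself, rather than its bit length, is to be at most \<open>B\<close>.
  This is affordable because the counters are bounded by numbers of bids and steps, each of which
  adds to the encoding length.\<close>

lemma wp_iset:
  assumes "index_val s e \<le> B" "Q (put_idx v 0 (index_val s e) s)"
  shows "wp (ISet v e) Q s"
proof -
  let ?s = "put_idx v 0 (index_val s e) s"
  have "ok ?s" if "ok s"
    using ok_put_idx[OF that] floorlog_le_self[of "index_val s e"] assms(1) by simp
  then show ?thesis
    unfolding wp_def using assms(2)
    by (intro impI exI[of _ "[?s]"] exI[of _ ?s]) (auto intro: exec.ISet)
qed

lemma wp_iput:
  assumes "Q (put_idx a (ivar s i) (ivar s v) s)"
  shows "wp (IPut a i v) Q s"
proof -
  let ?s = "put_idx a (ivar s i) (ivar s v) s"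
  have "ok ?s" if "ok s"
    using that by (auto simp: ok_def numbers_bounded_def ivar_def)
  then show ?thesis
    unfolding wp_def using assms
    by (intro impI exI[of _ "[?s]"] exI[of _ ?s]) (auto intro: exec.IPut)
qed

lemma wp_nset:
  assumes "R \<Longrightarrow> num_val s e \<in> \<rat> \<and> num_len (num_val s e) \<le> B"
    and "Q (put_num u (num_val s e) s)"
  shows "wp (NSet u e) Q s"
proof -
  let ?s = "put_num u (num_val s e) s"
  have "ok ?s" if "ok s" using ok_put_num[OF that] assms(1) by blast
  then show ?thesis
    unfolding wp_def using assms(2)
    by (intro impI exI[of _ "[?s]"] exI[of _ ?s]) (auto intro: exec.NSet)
qed

lemma wp_ncopy:
  assumes "Q (put_num u (cell_val s w) s)"
  shows "wp (NSet u (NCopy w)) Q s"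
proof (cases "ok s")
  case True
  then have "R \<longrightarrow> numbers_bounded B s" by (simp only: ok_def)
  then have "R \<Longrightarrow> cell_val s w \<in> \<rat> \<and> num_len (cell_val s w) \<le> B"
    by (cases w) (auto simp: numbers_bounded_def)
  then show ?thesis using assms by (intro wp_nset) auto
qed (simp add: wp_def)

lemma wp_mono: "wp c P s \<Longrightarrow> (\<And>s. P s \<Longrightarrow> Q s) \<Longrightarrow> wp c Q s"
  unfolding wp_def by blast

lemma wp_nmul:
  assumes "R \<Longrightarrow> cell_val s w1 * cell_val s w2 \<in> \<rat> \<and> num_len (cell_val s w1 * cell_val s w2) \<le> B"
    and "Q (put_num u (cell_val s w1 * cell_val s w2) s)"
  shows "wp (NSet u (NMul w1 w2)) Q s"
  using assms by (intro wp_nset) auto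

lemma wp_nadd:
  assumes "R \<Longrightarrow> cell_val s w1 + cell_val s w2 \<in> \<rat> \<and> num_len (cell_val s w1 + cell_val s w2) \<le> B"
    and "Q (put_num u (cell_val s w1 + cell_val s w2) s)"
  shows "wp (NSet u (NAdd w1 w2)) Q s"
  using assms by (intro wp_nset) auto

lemma wp_one: "Q (put_num u 1 s) \<Longrightarrow> wp (NSet u (NConst 1)) Q s"
  using B by (intro wp_nset) auto

lemma wp_seq:
  assumes "wp c1 (\<lambda>s1. wp c2 Q s1) s"
  shows "wp (Seq c1 c2) Q s"
  unfolding wp_def
proof
  assume "ok s"
  with assms obtain tr1 s1 where 1: "exec c1 s tr1 s1" "ok s1" "wp c2 Q s1" "length tr1 \<le> ops d c1"
    "\<forall>u\<in>set tr1. ok u" by (auto simp: wp_def)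
  then obtain tr2 s2 where "exec c2 s1 tr2 s2" "ok s2" "Q s2" "length tr2 \<le> ops d c2"
    "\<forall>u\<in>set tr2. ok u" by (auto simp: wp_def)
  with 1 show "\<exists>tr s'. exec (Seq c1 c2) s tr s' \<and> ok s' \<and> Q s' \<and>
      length tr \<le> ops d (Seq c1 c2) \<and> (\<forall>u\<in>set tr. ok u)"
    by (intro exI[of _ "tr1 @ tr2"] exI[of _ s2]) (auto intro: exec.Seq)
qed

lemma wp_cond:
  assumes "test_val s b \<Longrightarrow> wp c1 Q s" "\<not> test_val s b \<Longrightarrow> wp c2 Q s"
  shows "wp (Cond b c1 c2) Q s"
  unfolding wp_def
proof
  assume ok: "ok s"
  show "\<exists>tr s'. exec (Cond b c1 c2) s tr s' \<and> ok s' \<and> Q s' \<and>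
      length tr \<le> ops d (Cond b c1 c2) \<and> (\<forall>u\<in>set tr. ok u)"
  proof (cases "test_val s b")
    case True
    with assms ok obtain tr s' where "exec c1 s tr s'" "ok s'" "Q s'" "length tr \<le> ops d c1"
      "\<forall>u\<in>set tr. ok u" by (auto simp: wp_def)
    with True ok show ?thesis
      by (intro exI[of _ "s # tr"] exI[of _ s']) (auto intro: exec.CondT)
  next
    case False
    with assms ok obtain tr s' where "exec c2 s tr s'" "ok s'" "Q s'" "length tr \<le> ops d c2"
      "\<forall>u\<in>set tr. ok u" by (auto simp: wp_def)
    with False ok show ?thesis
      by (intro exI[of _ "s # tr"] exI[of _ s']) (auto intro: exec.CondF)
  qed
qed

text \<open>\<open>J k\<close> holds whenever the loop test is reached with counter
  \<open>k\<close>. The body must preserve the counter and \<open>''one''\<close>, and establish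
  \<open>J (Suc k)\<close> for the state after the increment. Of the bounds on \<open>N\<close>, the
  one by \<open>B\<close> keeps the counter short and the one by \<open>d\<close> limits the
  operations.\<close>

lemma wp_for:
  assumes start: "J 0 (put_idx v 0 0 s)"
    and ctrl: "\<And>k s. k \<le> N \<Longrightarrow> J k s \<Longrightarrow> ivar s v = k \<and> ivar s u = N"
    and body: "\<And>k s. k < N \<Longrightarrow> J k s \<Longrightarrow>
      wp c (\<lambda>s'. ivar s' v = k \<and> ivar s' ''one'' = 1 \<and> J (Suc k) (put_idx v 0 (Suc k) s')) s"
    and N: "N \<le> B" "N \<le> d"
    and final: "\<And>s. J N s \<Longrightarrow> Q s"
  shows "wp (for_loop v u c) Q s"
proof -
  let ?b = "Seq c (ISet v (IAdd v ''one''))" and ?t = "ILess v u"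
  have loop: "\<exists>tr s'. exec (Loop ?t ?b) s tr s' \<and> ok s' \<and> Q s' \<and>
      length tr \<le> 1 + (N - k) * (1 + ops d ?b) \<and> (\<forall>u\<in>set tr. ok u)"
    if "k \<le> N" "J k s" "ok s" for k s
    using that
  proof (induction "N - k" arbitrary: k s)
    case 0
    then have "\<not> test_val s ?t" "Q s" using ctrl[of k s] final by auto
    with 0 show ?case by (intro exI[of _ "[s]"] exI[of _ s]) (auto intro: exec.LoopF)
  next
    case (Suc l)
    then have k: "k < N" by simp
    have "wp ?b (J (Suc k)) s"
    proof (rule wp_seq)
      have iset: "wp (ISet v (IAdd v ''one'')) (J (Suc k)) s'"
        if "ivar s' v = k \<and> ivar s' ''one'' = 1 \<and> J (Suc k) (put_idx v 0 (Suc k) s')" for s'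
        using that k N by (intro wp_iset) auto
      from body[OF k Suc.prems(2)] show "wp c (wp (ISet v (IAdd v ''one'')) (J (Suc k))) s"
        unfolding wp_def[of c] using iset by blast
    qed
    with Suc.prems obtain tr1 s1 where 1: "exec ?b s tr1 s1" "ok s1" "J (Suc k) s1"
      "length tr1 \<le> ops d ?b" "\<forall>u\<in>set tr1. ok u" by (auto simp: wp_def)
    have "\<exists>tr s'. exec (Loop ?t ?b) s1 tr s' \<and> ok s' \<and> Q s' \<and>
        length tr \<le> 1 + (N - Suc k) * (1 + ops d ?b) \<and> (\<forall>u\<in>set tr. ok u)"
      using Suc.hyps(2) k 1 by (intro Suc.hyps(1)) auto
    then obtain tr2 s2 where 2: "exec (Loop ?t ?b) s1 tr2 s2" "ok s2" "Q s2"
      "length tr2 \<le> 1 + (N - Suc k) * (1 + ops d ?b)" "\<forall>u\<in>set tr2. ok u" by blast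
    have "test_val s ?t" using ctrl[OF Suc.prems(1,2)] k by simp
    moreover have "N - k = Suc (N - Suc k)" using k by simp
    ultimately show ?case
      using 1 2 Suc.prems(3)
      by (intro exI[of _ "s # tr1 @ tr2"] exI[of _ s2]) (auto intro: exec.LoopT)
  qed
  have "wp (Loop ?t ?b) Q s" if J: "J 0 s" for s
    unfolding wp_def
  proof
    assume "ok s"
    then obtain tr s' where "exec (Loop ?t ?b) s tr s'" "ok s'" "Q s'"
      "length tr \<le> 1 + N * (1 + ops d ?b)" "\<forall>u\<in>set tr. ok u"
      using loop[of 0 s] J by auto
    moreover have "1 + N * (1 + ops d ?b) \<le> ops d (Loop ?t ?b)"
      using N by (simp del: mult_Suc_right)
    ultimately show "\<exists>tr s'. exec (Loop ?t ?b) s tr s' \<and> ok s' \<and> Q s' \<and>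
        length tr \<le> ops d (Loop ?t ?b) \<and> (\<forall>u\<in>set tr. ok u)"
      by (meson order.trans)
  qed
  with start show ?thesis unfolding for_loop_def by (intro wp_seq wp_iset) auto
qed

end

text \<open>The size \<open>sz i\<close> serves as the bound on loop iterations, so
  \<open>ops_poly\<close> provides the operation polynomial from the program alone.\<close>

lemma strongly_polynomialI:
  fixes Q :: "nat poly"
  assumes Q: "\<And>l. 3 \<le> poly Q l"
    and load: "\<And>i. i \<in> D \<Longrightarrow> rational i \<Longrightarrow> numbers_bounded (poly Q (len i)) (load i)"
    and run: "\<And>i. i \<in> D \<Longrightarrow>
      bounded_machine.wp (rational i) (poly Q (len i)) (sz i) c (\<lambda>s. read s = f i) (load i)"
  shows "strongly_polynomial D load read sz rational len f"
proof -
  obtain P :: "nat poly" where P: "\<forall>d. ops d c = poly P d" using ops_poly by blast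
  show ?thesis
    unfolding strongly_polynomial_def
  proof (rule exI[of _ c], rule exI[of _ P], rule exI[of _ Q], rule ballI)
    fix i assume i: "i \<in> D"
    interpret bounded_machine "rational i" "poly Q (len i)" "sz i"
      by unfold_locales (rule Q)
    have "ok (load i)" using load[OF i] by (simp add: ok_def)
    then have "\<exists>tr s'. exec c (load i) tr s' \<and> ok s' \<and> read s' = f i \<and>
        length tr \<le> ops (sz i) c \<and> (\<forall>u\<in>set tr. ok u)"
      using run[OF i] by (simp only: wp_def)
    then show "\<exists>tr s'. exec c (load i) tr s' \<and> read s' = f i \<and> length tr \<le> poly P (sz i) \<and>
        (rational i \<longrightarrow> (\<forall>s\<in>set tr. numbers_bounded (poly Q (len i)) s))"
      unfolding ok_def P[rule_format] by blast
  qed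
qed

section \<open>Dimensions and input data bounded by the encoding length\<close>

lemma goods_le_total_steps:
  assumes "arctic_auction A"
  shows "goods A \<le> total_steps A"
proof -
  have "(\<Sum>i<goods A. 1) \<le> (\<Sum>i<goods A. steps A i)"
    using assms by (intro sum_mono) (auto simp: arctic_auction_def)
  then show ?thesis by (simp add: total_steps_def offset_def)
qed

lemma steps_le_total_steps:
  assumes "i < goods A"
  shows "steps A i \<le> total_steps A"
  unfolding total_steps_def offset_def using assms by (intro member_le_sum) auto

lemma auction_dim_eq: "auction_dim A = goods A + bids A + total_steps A"
  by (simp add: auction_dim_def total_steps_def offset_def)

text \<open>Every number has length at least 1, so each bid counts through its budget and each step
  through its width.\<close>

lemma dim_le_auction_len: "bids A + total_steps A \<le> auction_len A"
proof -
  have "(\<Sum>j<bids A. 1) \<le> (\<Sum>j<bids A. num_len (budget A j) + (\<Sum>i<goods A. num_len (val A j i)))"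
    by (intro sum_mono trans_le_add1 num_len_pos)
  moreover have "(\<Sum>i<goods A. \<Sum>k<steps A i. 1) \<le>
      (\<Sum>i<goods A. \<Sum>k<steps A i. num_len (width A i k) + num_len (mcost A i k))"
    by (intro sum_mono trans_le_add1 num_len_pos)
  ultimately show ?thesis
    by (simp add: auction_len_def total_steps_def offset_def)
qed

lemma member_le_sum2:
  fixes f :: "nat \<Rightarrow> nat \<Rightarrow> nat"
  assumes "i < n" "k < K i"
  shows "f i k \<le> (\<Sum>i<n. \<Sum>k<K i. f i k)"
proof -
  have "f i k \<le> (\<Sum>k<K i. f i k)" using assms by (intro member_le_sum) auto
  also have "\<dots> \<le> (\<Sum>i<n. \<Sum>k<K i. f i k)"
    using assms member_le_sum[of i "{..<n}" "\<lambda>i. \<Sum>k<K i. f i k"] by auto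
  finally show ?thesis .
qed

lemma data_le_auction_len:
  shows "floorlog 2 (bids A) \<le> auction_len A"
    and "i < goods A \<Longrightarrow> floorlog 2 (steps A i) \<le> auction_len A"
    and "j < bids A \<Longrightarrow> num_len (budget A j) \<le> auction_len A"
    and "j < bids A \<Longrightarrow> i < goods A \<Longrightarrow> num_len (val A j i) \<le> auction_len A"
    and "i < goods A \<Longrightarrow> k < steps A i \<Longrightarrow>
      num_len (width A i k) + num_len (mcost A i k) \<le> auction_len A"
proof -
  show "floorlog 2 (steps A i) \<le> auction_len A" if "i < goods A"
    using member_le_sum[of i "{..<goods A}" "\<lambda>i. floorlog 2 (steps A i)"] that
    by (simp add: auction_len_def)
  show "num_len (budget A j) \<le> auction_len A" if "j < bids A"
    using member_le_sum[of j "{..<bids A}" "\<lambda>j. num_len (budget A j) + (\<Sum>i<goods A. num_len (val A j i))"] that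
    by (simp add: auction_len_def)
  show "num_len (val A j i) \<le> auction_len A" if "j < bids A" "i < goods A"
    using member_le_sum2[of j "bids A" i "\<lambda>_. goods A" "\<lambda>j i. num_len (val A j i)"] that
    by (simp add: auction_len_def sum.distrib)
  show "num_len (width A i k) + num_len (mcost A i k) \<le> auction_len A" if "i < goods A" "k < steps A i"
    using member_le_sum2[of i "goods A" k "steps A" "\<lambda>i k. num_len (width A i k) + num_len (mcost A i k)"] that
    by (simp add: auction_len_def)
qed (simp_all add: auction_len_def)

lemma load_auction_bounded:
  assumes A: "rational_auction A" and B: "auction_len A + 3 \<le> B"
  shows "numbers_bounded B (load_auction A)"
proof -
  have "floorlog 2 (goods A) \<le> B" using B by (simp add: auction_len_def)
  moreover have "floorlog 2 (bids A) \<le> B" "i < goods A \<Longrightarrow> floorlog 2 (steps A i) \<le> B" for i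
    using data_le_auction_len(1)[of A] data_le_auction_len(2)[of _ A] B by (meson add_leD1 order.trans)+
  moreover have "floorlog 2 0 \<le> B" by (simp add: floorlog_def)
  ultimately have 1: "floorlog 2 (idx (load_auction A) a i) \<le> B" for a i
    by (simp add: load_auction_def)
  have "num_len (budget A j) \<le> B" if "j < bids A" for j
    using data_le_auction_len(3)[OF that] B by simp
  moreover have "num_len (val A j i) \<le> B" if "j < bids A" "i < goods A" for i j
    using data_le_auction_len(4)[OF that] B by simp
  moreover have "num_len (width A i k) \<le> B" "num_len (mcost A i k) \<le> B" if "i < goods A" "k < steps A i" for i k
    using data_le_auction_len(5)[OF that] B by simp_all
  moreover have "2 \<le> B" using B by simp
  ultimately have "num (load_auction A) a i j \<in> \<rat> \<and> num_len (num (load_auction A) a i j) \<le> B" for a i j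
    using A by (simp add: load_auction_def rational_auction_def)
  with 1 show ?thesis by (simp add: numbers_bounded_def)
qed

section \<open>The forward program\<close>

text \<open>
  The index variable \<open>zero\<close> and the array \<open>null\<close> are never written, hence 0 throughout. Goods of the
  reduced auction are produced in order, so that the index variable \<open>g\<close> replaces any computation of
  \<open>offset\<close>.
\<close>

definition forward_values_prog :: prog where
  "forward_values_prog =
     for_loop ''j'' ''m'' (NSet (Cell ''r_out'' ''j'' ''g'') (NCopy (Cell ''r'' ''j'' ''i'')))"

definition forward_step_prog :: prog where
  "forward_step_prog =
     Seq (ISet ''b'' (IAdd ''m'' ''g''))
    (Seq (IPut ''K_out'' ''g'' ''one'')
    (Seq (NSet (Cell ''s_out'' ''g'' ''zero'') (NCopy (Cell ''s'' ''i'' ''k'')))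
    (Seq (NSet (Cell ''beta_out'' ''b'' ''zero'') (NMul (Cell ''c'' ''i'' ''k'') (Cell ''s'' ''i'' ''k'')))
    (Seq (Cond (NLess (Cell ''null'' ''zero'' ''zero'') (Cell ''c'' ''i'' ''k''))
           (NSet (Cell ''r_out'' ''b'' ''g'') (NCopy (Cell ''c'' ''i'' ''k'')))
           (NSet (Cell ''r_out'' ''b'' ''g'') (NConst 1)))
         (ISet ''g'' (IAdd ''g'' ''one''))))))"

text \<open>Adding \<open>''zero''\<close> copies an index variable; the final value of
  \<open>''g''\<close> is the total number of steps.\<close>

definition forward_prog :: prog where
  "forward_prog =
     Seq (ISet ''one'' (IConst 1))
    (Seq (for_loop ''j'' ''m'' (NSet (Cell ''beta_out'' ''j'' ''zero'') (NCopy (Cell ''beta'' ''j'' ''zero''))))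
    (Seq (for_loop ''i'' ''n''
       (Seq (ISet ''K_i'' (IGet ''K'' ''i''))
            (for_loop ''k'' ''K_i'' (Seq forward_values_prog forward_step_prog))))
    (Seq (ISet ''n_out'' (IAdd ''g'' ''zero''))
         (ISet ''m_out'' (IAdd ''m'' ''g'')))))"

text \<open>The part of the loaded input on which both programs rely; the data in
  \<open>auction_loaded\<close> are read by the forward program only.\<close>

definition input_loaded :: "auction \<Rightarrow> state \<Rightarrow> bool" where
  "input_loaded A s \<longleftrightarrow>
     ivar s ''n'' = goods A \<and> ivar s ''m'' = bids A \<and> ivar s ''one'' = 1 \<and> ivar s ''zero'' = 0 \<and>
     (\<forall>i<goods A. idx s ''K'' i = steps A i)"

definition auction_loaded :: "auction \<Rightarrow> state \<Rightarrow> bool" where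
  "auction_loaded A s \<longleftrightarrow>
     num s ''null'' 0 0 = 0 \<and>
     (\<forall>j<bids A. num s ''beta'' j 0 = budget A j) \<and>
     (\<forall>j<bids A. \<forall>i<goods A. num s ''r'' j i = val A j i) \<and>
     (\<forall>i<goods A. \<forall>k<steps A i. num s ''s'' i k = width A i k \<and> num s ''c'' i k = mcost A i k)"

text \<open>
  The first \<open>l\<close> original budgets and the first \<open>g\<close> goods of the reduced auction are complete; of
  good \<open>g\<close>, the values of the first \<open>j\<close> bids are written.
\<close>

definition forward_state :: "auction \<Rightarrow> nat \<Rightarrow> nat \<Rightarrow> nat \<Rightarrow> state \<Rightarrow> bool" where
  "forward_state A l g j s \<longleftrightarrow>
     input_loaded A s \<and> auction_loaded A s \<and> ivar s ''g'' = g \<and>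
     (\<forall>h. idx s ''K_out'' h = (if h < g then 1 else 0)) \<and>
     (\<forall>h k. num s ''s_out'' h k = (if h < g \<and> k = 0 then step_width A h else 0)) \<and>
     (\<forall>h k. num s ''c_out'' h k = 0) \<and>
     (\<forall>b h. num s ''r_out'' b h = (if h < g \<or> h = g \<and> b < j then reduced_val A b h else 0)) \<and>
     (\<forall>b. num s ''beta_out'' b 0 =
        (if b < l then budget A b
         else if bids A \<le> b \<and> b < bids A + g
         then step_cost A (b - bids A) * step_width A (b - bids A) else 0))"

lemma forward_state_put_idx [simp]:
  assumes "v \<in> {''i'', ''j'', ''k'', ''b'', ''K_i''}"
  shows "forward_state A l g j (put_idx v 0 x s) = forward_state A l g j s"
  using assms
  by (elim insertE emptyE) (simp_all add: forward_state_def input_loaded_def auction_loaded_def)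

lemma forward_stateD:
  assumes "forward_state A l g j s"
  shows "ivar s ''n'' = goods A" "ivar s ''m'' = bids A" "ivar s ''one'' = 1" "ivar s ''zero'' = 0"
    "ivar s ''g'' = g" "i < goods A \<Longrightarrow> idx s ''K'' i = steps A i"
    "num s ''null'' 0 0 = 0"
    "b < bids A \<Longrightarrow> num s ''beta'' b 0 = budget A b"
    "b < bids A \<Longrightarrow> i < goods A \<Longrightarrow> num s ''r'' b i = val A b i"
    "i < goods A \<Longrightarrow> k < steps A i \<Longrightarrow> num s ''s'' i k = width A i k"
    "i < goods A \<Longrightarrow> k < steps A i \<Longrightarrow> num s ''c'' i k = mcost A i k"
  using assms by (auto simp: forward_state_def input_loaded_def auction_loaded_def)

lemma forward_state_value:
  assumes "forward_state A l g j s" "ivar s ''j'' = j" "ivar s ''g'' = g" "x = reduced_val A j g"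
  shows "forward_state A l g (Suc j) (put_num (Cell ''r_out'' ''j'' ''g'') x s)"
  using assms unfolding forward_state_def input_loaded_def auction_loaded_def
  by (auto simp: less_Suc_eq)

text \<open>The new state is described by its differences from the old one, so both branches of the
  conditional are instances. In column \<open>g\<close>, entries of additional bids other than the
  one for \<open>g\<close> stay 0, as \<open>reduced_val\<close> requires.\<close>

lemma forward_state_next_good:
  assumes s: "forward_state A (bids A) g (bids A) s"
    and s': "\<And>h. idx s' ''K'' h = idx s ''K'' h" "ivar s' ''n'' = ivar s ''n''" "ivar s' ''m'' = ivar s ''m''"
      "ivar s' ''one'' = ivar s ''one''" "ivar s' ''zero'' = ivar s ''zero''" "ivar s' ''g'' = Suc g"
      "\<And>h. idx s' ''K_out'' h = (if h = g then 1 else idx s ''K_out'' h)"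
      "\<And>a h k. a \<notin> {''s_out'', ''r_out'', ''beta_out''} \<Longrightarrow> num s' a h k = num s a h k"
      "\<And>h k. num s' ''s_out'' h k = (if h = g \<and> k = 0 then step_width A g else num s ''s_out'' h k)"
      "\<And>b h. num s' ''r_out'' b h =
         (if b = bids A + g \<and> h = g then reduced_val A b h else num s ''r_out'' b h)"
      "\<And>b. num s' ''beta_out'' b 0 =
         (if b = bids A + g then step_cost A g * step_width A g else num s ''beta_out'' b 0)"
  shows "forward_state A (bids A) (Suc g) 0 s'"
proof -
  have "num s' ''r_out'' b h = (if h < Suc g then reduced_val A b h else 0)" for b h
    using s by (auto simp: s' forward_state_def reduced_val_def less_Suc_eq)
  moreover have "num s' ''beta_out'' b 0 =
        (if b < bids A then budget A b
         else if bids A \<le> b \<and> b < bids A + Suc g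
         then step_cost A (b - bids A) * step_width A (b - bids A) else 0)" for b
    using s by (auto simp: s' forward_state_def less_Suc_eq)
  ultimately show ?thesis
    using s by (auto simp: s' forward_state_def input_loaded_def auction_loaded_def less_Suc_eq)
qed

lemma load_auction_state:
  "forward_state A 0 0 0 (put_idx ''one'' 0 1 (load_auction A))"
  by (simp add: forward_state_def input_loaded_def auction_loaded_def load_auction_def ivar_def)

lemma read_reduced:
  assumes "forward_state A (bids A) (total_steps A) 0 s"
    "ivar s ''n_out'' = total_steps A" "ivar s ''m_out'' = bids A + total_steps A"
  shows "read_auction s = reduced A"
proof -
  have "bids A \<le> b \<and> b < bids A + total_steps A \<longleftrightarrow> \<not> b < bids A \<and> b < bids A + total_steps A" for b
    by auto
  then show ?thesis
    using assms by (simp add: read_auction_def reduced_def forward_state_def ivar_def fun_eq_iff cong: if_cong)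
qed

context bounded_machine begin

lemma sizes_le:
  assumes A: "arctic_auction A" and dim: "auction_dim A \<le> d" "bids A + total_steps A \<le> B"
  shows "goods A \<le> d" "bids A \<le> d" "goods A \<le> B" "bids A \<le> B" "total_steps A \<le> B"
    "i < goods A \<Longrightarrow> steps A i \<le> d" "i < goods A \<Longrightarrow> steps A i \<le> B"
  using dim goods_le_total_steps[OF A] steps_le_total_steps[of i A] by (auto simp: auction_dim_eq)

context
  fixes A
  assumes A: "arctic_auction A" and dim: "auction_dim A \<le> d" "bids A + total_steps A \<le> B"
    and prod: "\<And>i k. R \<Longrightarrow> i < goods A \<Longrightarrow> k < steps A i \<Longrightarrow>
      mcost A i k * width A i k \<in> \<rat> \<and> num_len (mcost A i k * width A i k) \<le> B"
begin

lemma forward_values: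
  assumes s: "forward_state A (bids A) (offset A i + k) 0 s" "i < goods A" "k < steps A i"
    "ivar s ''i'' = i" "ivar s ''k'' = k" "ivar s ''K_i'' = steps A i"
    and Q: "\<And>s. forward_state A (bids A) (offset A i + k) (bids A) s \<Longrightarrow>
      ivar s ''i'' = i \<Longrightarrow> ivar s ''k'' = k \<Longrightarrow> ivar s ''K_i'' = steps A i \<Longrightarrow> Q s"
  shows "wp forward_values_prog Q s"
  unfolding forward_values_prog_def
proof (rule wp_for[where N = "bids A" and J = "\<lambda>j s. forward_state A (bids A) (offset A i + k) j s \<and>
    ivar s ''j'' = j \<and> ivar s ''i'' = i \<and> ivar s ''k'' = k \<and> ivar s ''K_i'' = steps A i"])
  fix j s assume j: "j < bids A" and J: "forward_state A (bids A) (offset A i + k) j s \<and>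
    ivar s ''j'' = j \<and> ivar s ''i'' = i \<and> ivar s ''k'' = k \<and> ivar s ''K_i'' = steps A i"
  then show "wp (NSet (Cell ''r_out'' ''j'' ''g'') (NCopy (Cell ''r'' ''j'' ''i'')))
    (\<lambda>s'. ivar s' ''j'' = j \<and> ivar s' ''one'' = 1 \<and>
      forward_state A (bids A) (offset A i + k) (Suc j) (put_idx ''j'' 0 (Suc j) s') \<and>
      ivar (put_idx ''j'' 0 (Suc j) s') ''j'' = Suc j \<and> ivar (put_idx ''j'' 0 (Suc j) s') ''i'' = i \<and>
      ivar (put_idx ''j'' 0 (Suc j) s') ''k'' = k \<and> ivar (put_idx ''j'' 0 (Suc j) s') ''K_i'' = steps A i) s"
    using s(2,3) by (intro wp_ncopy) (auto simp: forward_stateD intro!: forward_state_value)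
qed (use s Q sizes_le[OF A dim] in \<open>auto simp: forward_stateD\<close>)

lemma forward_step:
  assumes s: "forward_state A (bids A) (offset A i + k) (bids A) s" and ik: "i < goods A" "k < steps A i"
    "ivar s ''i'' = i" "ivar s ''k'' = k" "ivar s ''K_i'' = steps A i"
  shows "wp forward_step_prog (\<lambda>s'. forward_state A (bids A) (offset A i + Suc k) 0 s' \<and>
    ivar s' ''i'' = i \<and> ivar s' ''k'' = k \<and> ivar s' ''K_i'' = steps A i) s"
proof -
  note D = forward_stateD[OF s]
  have "offset A i + k < total_steps A" using ik offset_less_total by blast
  then have le: "bids A + (offset A i + k) \<le> B" "Suc (offset A i + k) \<le> B" using dim by auto
  show ?thesis
    unfolding forward_step_prog_def
    apply (intro wp_seq wp_iset wp_iput wp_ncopy wp_nmul wp_one wp_cond conjI)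
    using le prod[OF _ ik(1,2)]
    apply (simp_all add: D ik)
    \<comment> \<open>The two goals left are the branches of the conditional: the additional bid
      gets its marginal cost as value, or 1.\<close>
    apply (rule forward_state_next_good[OF s]; simp add: D ik reduced_val_def)
    apply (rule forward_state_next_good[OF s]; simp add: D ik reduced_val_def)
    done
qed

lemma forward_good:
  assumes s: "forward_state A (bids A) (offset A i) 0 s" "i < goods A" "ivar s ''i'' = i"
  shows "wp (Seq (ISet ''K_i'' (IGet ''K'' ''i'')) (for_loop ''k'' ''K_i'' (Seq forward_values_prog forward_step_prog)))
    (\<lambda>s'. forward_state A (bids A) (offset A (Suc i)) 0 s' \<and> ivar s' ''i'' = i) s"
proof (intro wp_seq wp_iset)
  show "index_val s (IGet ''K'' ''i'') \<le> B"
    using s sizes_le[OF A dim] by (simp add: forward_stateD)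
  show "wp (for_loop ''k'' ''K_i'' (Seq forward_values_prog forward_step_prog))
    (\<lambda>s'. forward_state A (bids A) (offset A (Suc i)) 0 s' \<and> ivar s' ''i'' = i)
    (put_idx ''K_i'' 0 (index_val s (IGet ''K'' ''i'')) s)"
  proof (rule wp_for[where N = "steps A i" and J = "\<lambda>k s. forward_state A (bids A) (offset A i + k) 0 s \<and>
      ivar s ''i'' = i \<and> ivar s ''k'' = k \<and> ivar s ''K_i'' = steps A i"])
    fix k s assume k: "k < steps A i" and J: "forward_state A (bids A) (offset A i + k) 0 s \<and>
      ivar s ''i'' = i \<and> ivar s ''k'' = k \<and> ivar s ''K_i'' = steps A i"
    show "wp (Seq forward_values_prog forward_step_prog)
      (\<lambda>s'. ivar s' ''k'' = k \<and> ivar s' ''one'' = 1 \<and>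
        forward_state A (bids A) (offset A i + Suc k) 0 (put_idx ''k'' 0 (Suc k) s') \<and>
        ivar (put_idx ''k'' 0 (Suc k) s') ''i'' = i \<and> ivar (put_idx ''k'' 0 (Suc k) s') ''k'' = Suc k \<and>
        ivar (put_idx ''k'' 0 (Suc k) s') ''K_i'' = steps A i) s"
      using J k s(2)
      by (intro wp_seq forward_values) (auto simp: forward_stateD intro!: wp_mono[OF forward_step])
  qed (use s sizes_le[OF A dim] in \<open>auto simp: forward_stateD\<close>)
qed

lemma forward_budgets:
  assumes s: "forward_state A 0 0 0 s" and Q: "\<And>s. forward_state A (bids A) 0 0 s \<Longrightarrow> Q s"
  shows "wp (for_loop ''j'' ''m'' (NSet (Cell ''beta_out'' ''j'' ''zero'') (NCopy (Cell ''beta'' ''j'' ''zero'')))) Q s"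
proof (rule wp_for[where N = "bids A" and J = "\<lambda>j s. forward_state A j 0 0 s \<and> ivar s ''j'' = j"])
  fix j s assume j: "j < bids A" and J: "forward_state A j 0 0 s \<and> ivar s ''j'' = j"
  then have "forward_state A (Suc j) 0 0 (put_num (Cell ''beta_out'' ''j'' ''zero'') (num s ''beta'' j 0) s)"
    unfolding forward_state_def input_loaded_def auction_loaded_def by (auto simp: less_Suc_eq)
  with J show "wp (NSet (Cell ''beta_out'' ''j'' ''zero'') (NCopy (Cell ''beta'' ''j'' ''zero'')))
     (\<lambda>s'. ivar s' ''j'' = j \<and> ivar s' ''one'' = 1 \<and>
       forward_state A (Suc j) 0 0 (put_idx ''j'' 0 (Suc j) s') \<and> ivar (put_idx ''j'' 0 (Suc j) s') ''j'' = Suc j) s"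
    by (intro wp_ncopy) (auto simp: forward_stateD)
qed (use s Q sizes_le[OF A dim] in \<open>auto simp: forward_stateD\<close>)

lemma forward_finish:
  assumes s: "forward_state A (bids A) (total_steps A) 0 s"
  shows "wp (Seq (ISet ''n_out'' (IAdd ''g'' ''zero'')) (ISet ''m_out'' (IAdd ''m'' ''g'')))
     (\<lambda>s. read_auction s = reduced A) s"
proof (intro wp_seq wp_iset)
  let ?s = "put_idx ''n_out'' 0 (index_val s (IAdd ''g'' ''zero'')) s"
  show "index_val s (IAdd ''g'' ''zero'') \<le> B" "index_val ?s (IAdd ''m'' ''g'') \<le> B"
    using s sizes_le[OF A dim] dim by (simp_all add: forward_stateD)
  let ?t = "put_idx ''m_out'' 0 (index_val ?s (IAdd ''m'' ''g'')) ?s"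
  have "forward_state A (bids A) (total_steps A) 0 ?t"
    using s by (simp add: forward_state_def input_loaded_def auction_loaded_def)
  then show "read_auction ?t = reduced A"
    by (rule read_reduced) (use s in \<open>simp_all add: forward_stateD\<close>)
qed

lemma forward_correct: "wp forward_prog (\<lambda>s. read_auction s = reduced A) (load_auction A)"
  unfolding forward_prog_def
proof (rule wp_seq, rule wp_iset)
  show "index_val (load_auction A) (IConst 1) \<le> B" using B by simp
  show "wp (Seq (for_loop ''j'' ''m'' (NSet (Cell ''beta_out'' ''j'' ''zero'') (NCopy (Cell ''beta'' ''j'' ''zero''))))
    (Seq (for_loop ''i'' ''n''
       (Seq (ISet ''K_i'' (IGet ''K'' ''i''))
            (for_loop ''k'' ''K_i'' (Seq forward_values_prog forward_step_prog))))
    (Seq (ISet ''n_out'' (IAdd ''g'' ''zero''))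
         (ISet ''m_out'' (IAdd ''m'' ''g'')))))
    (\<lambda>s. read_auction s = reduced A) (put_idx ''one'' 0 (index_val (load_auction A) (IConst 1)) (load_auction A))"
  proof (rule wp_seq, rule forward_budgets)
    fix s assume s: "forward_state A (bids A) 0 0 s"
    show "wp (Seq (for_loop ''i'' ''n''
       (Seq (ISet ''K_i'' (IGet ''K'' ''i''))
            (for_loop ''k'' ''K_i'' (Seq forward_values_prog forward_step_prog))))
      (Seq (ISet ''n_out'' (IAdd ''g'' ''zero'')) (ISet ''m_out'' (IAdd ''m'' ''g''))))
      (\<lambda>s. read_auction s = reduced A) s"
    proof (rule wp_seq, rule wp_for[where N = "goods A" and
        J = "\<lambda>i s. forward_state A (bids A) (offset A i) 0 s \<and> ivar s ''i'' = i"])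
      fix i s assume "i < goods A" and "forward_state A (bids A) (offset A i) 0 s \<and> ivar s ''i'' = i"
      then show "wp (Seq (ISet ''K_i'' (IGet ''K'' ''i''))
            (for_loop ''k'' ''K_i'' (Seq forward_values_prog forward_step_prog)))
        (\<lambda>s'. ivar s' ''i'' = i \<and> ivar s' ''one'' = 1 \<and>
          forward_state A (bids A) (offset A (Suc i)) 0 (put_idx ''i'' 0 (Suc i) s') \<and>
          ivar (put_idx ''i'' 0 (Suc i) s') ''i'' = Suc i) s"
        by (auto simp: forward_stateD intro!: wp_mono[OF forward_good] simp del: offset_Suc)
    next
      fix s assume "forward_state A (bids A) (offset A (goods A)) 0 s \<and> ivar s ''i'' = goods A"
      then show "wp (Seq (ISet ''n_out'' (IAdd ''g'' ''zero'')) (ISet ''m_out'' (IAdd ''m'' ''g'')))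
        (\<lambda>s. read_auction s = reduced A) s"
        using forward_finish[of s] by (simp add: total_steps_def)
    qed (use s sizes_le[OF A dim] in \<open>auto simp: forward_stateD\<close>)
  qed (use load_auction_state[of A] in simp)
qed

end
end

section \<open>The reverse program\<close>

definition reverse_price_prog :: prog where
  "reverse_price_prog =
     Cond (NLess (Cell ''p_in'' ''g'' ''zero'') (Cell ''p_out'' ''i'' ''zero''))
       (NSet (Cell ''p_out'' ''i'' ''zero'') (NCopy (Cell ''p_in'' ''g'' ''zero'')))
       Skip"

definition reverse_alloc_prog :: prog where
  "reverse_alloc_prog =
     for_loop ''j'' ''m''
       (NSet (Cell ''x_out'' ''j'' ''i'') (NAdd (Cell ''x_out'' ''j'' ''i'') (Cell ''x_in'' ''j'' ''g'')))"

text \<open>The running minimum starts with the price of the first step, which every good has; that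
  step is then compared with itself. The allocation sums start from output cells that still hold
  0.\<close>

definition reverse_good_prog :: prog where
  "reverse_good_prog =
     Seq (ISet ''K_i'' (IGet ''K'' ''i''))
    (Seq (NSet (Cell ''p_out'' ''i'' ''zero'') (NCopy (Cell ''p_in'' ''g'' ''zero'')))
         (for_loop ''k'' ''K_i''
           (Seq reverse_price_prog (Seq reverse_alloc_prog (ISet ''g'' (IAdd ''g'' ''one''))))))"

definition reverse_prog :: prog where
  "reverse_prog = Seq (ISet ''one'' (IConst 1)) (for_loop ''i'' ''n'' reverse_good_prog)"

text \<open>
  The first \<open>i\<close> goods are complete. The running minimum of the prices of good \<open>i\<close> is \<open>pk\<close>, and \<open>k\<close>
  of its steps, for the first \<open>j\<close> bids already \<open>Suc k\<close>, have been added up.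
\<close>

definition reverse_state ::
  "auction \<Rightarrow> (nat \<Rightarrow> real) \<Rightarrow> (nat \<Rightarrow> nat \<Rightarrow> real) \<Rightarrow> nat \<Rightarrow> nat \<Rightarrow> nat \<Rightarrow> real \<Rightarrow> state \<Rightarrow> bool" where
  "reverse_state A q x i k j pk s \<longleftrightarrow>
     input_loaded A s \<and> ivar s ''g'' = offset A i + k \<and>
     (\<forall>g<total_steps A. num s ''p_in'' g 0 = q g) \<and>
     (\<forall>b<bids A. \<forall>g<total_steps A. num s ''x_in'' b g = x b g) \<and>
     (\<forall>h. num s ''p_out'' h 0 =
        (if h < i then fst (recover (A, q, x)) h else if h = i then pk else 0)) \<and>
     (\<forall>b h. num s ''x_out'' b h =
        (if b < bids A \<and> h < i then \<Sum>k<steps A h. x b (offset A h + k)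
         else if b < bids A \<and> h = i then \<Sum>k<(if b < j then Suc k else k). x b (offset A i + k)
         else 0))"

lemma reverse_state_put_idx [simp]:
  assumes "v \<in> {''i'', ''j'', ''k'', ''K_i''}"
  shows "reverse_state A q x i k j pk (put_idx v 0 n s) = reverse_state A q x i k j pk s"
  using assms by (elim insertE emptyE) (simp_all add: reverse_state_def input_loaded_def)

lemma reverse_stateD:
  assumes "reverse_state A q x i k j pk s"
  shows "ivar s ''n'' = goods A" "ivar s ''m'' = bids A" "ivar s ''one'' = 1" "ivar s ''zero'' = 0"
    "ivar s ''g'' = offset A i + k" "h < goods A \<Longrightarrow> idx s ''K'' h = steps A h"
    "g < total_steps A \<Longrightarrow> num s ''p_in'' g 0 = q g"
    "b < bids A \<Longrightarrow> g < total_steps A \<Longrightarrow> num s ''x_in'' b g = x b g"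
    "num s ''p_out'' i 0 = pk"
    "j < bids A \<Longrightarrow> num s ''x_out'' j i = (\<Sum>k<k. x j (offset A i + k))"
  using assms by (auto simp: reverse_state_def input_loaded_def)

lemma reverse_state_price:
  assumes "reverse_state A q x i k j pk s" "ivar s ''i'' = i"
  shows "reverse_state A q x i k j y (put_num (Cell ''p_out'' ''i'' ''zero'') y s)"
  using assms by (auto simp: reverse_state_def input_loaded_def)

lemma reverse_state_alloc:
  assumes "reverse_state A q x i k j pk s" "ivar s ''i'' = i" "ivar s ''j'' = j" "j < bids A"
  shows "reverse_state A q x i k (Suc j) pk
    (put_num (Cell ''x_out'' ''j'' ''i'') (\<Sum>k<Suc k. x j (offset A i + k)) s)"
  using assms unfolding reverse_state_def input_loaded_def
  by (auto simp: less_Suc_eq simp del: sum.lessThan_Suc)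

lemma reverse_state_next_step:
  assumes "reverse_state A q x i k (bids A) pk s"
  shows "reverse_state A q x i (Suc k) 0 pk (put_idx ''g'' 0 (Suc (offset A i + k)) s)"
  using assms by (auto simp: reverse_state_def input_loaded_def)

text \<open>The last 0 is the untouched price cell of the next good, whose allocation sums are still
  empty.\<close>

lemma reverse_state_next_good:
  assumes "reverse_state A q x i (steps A i) 0 (fst (recover (A, q, x)) i) s"
  shows "reverse_state A q x (Suc i) 0 0 0 s"
  using assms by (auto simp: reverse_state_def less_Suc_eq)

lemma load_with_outcome_state:
  "reverse_state A q x 0 0 0 0 (put_idx ''one'' 0 1 (load_with_outcome A (reduced A) q x))"
  by (simp add: reverse_state_def input_loaded_def load_with_outcome_def load_auction_def ivar_def)

lemma read_recover:
  assumes "reverse_state A q x (goods A) 0 0 0 s"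
  shows "read_outcome s = recover (A, q, x)"
  using assms by (auto simp: reverse_state_def read_outcome_def recover_def fun_eq_iff)

context bounded_machine begin

context
  fixes A :: auction and q :: "nat \<Rightarrow> real" and x :: "nat \<Rightarrow> nat \<Rightarrow> real"
  assumes A: "arctic_auction A" and dim: "auction_dim A \<le> d" "bids A + total_steps A \<le> B"
    and sums: "\<And>i j k. R \<Longrightarrow> i < goods A \<Longrightarrow> j < bids A \<Longrightarrow> k \<le> steps A i \<Longrightarrow>
      (\<Sum>k<k. x j (offset A i + k)) \<in> \<rat> \<and> num_len (\<Sum>k<k. x j (offset A i + k)) \<le> B"
begin

lemma reverse_price:
  assumes s: "reverse_state A q x i k 0 pk s" "i < goods A" "k < steps A i"
    "ivar s ''i'' = i" "ivar s ''k'' = k" "ivar s ''K_i'' = steps A i"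
  shows "wp reverse_price_prog (\<lambda>s'. reverse_state A q x i k 0 (min pk (q (offset A i + k))) s' \<and>
    ivar s' ''i'' = i \<and> ivar s' ''k'' = k \<and> ivar s' ''K_i'' = steps A i) s"
proof -
  note D = reverse_stateD[OF s(1)] offset_less_total[OF s(2,3)]
  show ?thesis
    unfolding reverse_price_prog_def
  proof (intro wp_cond wp_ncopy wp_skip)
    assume "test_val s (NLess (Cell ''p_in'' ''g'' ''zero'') (Cell ''p_out'' ''i'' ''zero''))"
    then have "q (offset A i + k) < pk" using s by (simp add: D)
    then show "reverse_state A q x i k 0 (min pk (q (offset A i + k)))
        (put_num (Cell ''p_out'' ''i'' ''zero'') (cell_val s (Cell ''p_in'' ''g'' ''zero'')) s) \<and>
      ivar (put_num (Cell ''p_out'' ''i'' ''zero'') (cell_val s (Cell ''p_in'' ''g'' ''zero'')) s) ''i'' = i \<and>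
      ivar (put_num (Cell ''p_out'' ''i'' ''zero'') (cell_val s (Cell ''p_in'' ''g'' ''zero'')) s) ''k'' = k \<and>
      ivar (put_num (Cell ''p_out'' ''i'' ''zero'') (cell_val s (Cell ''p_in'' ''g'' ''zero'')) s) ''K_i'' = steps A i"
      using reverse_state_price[OF s(1,4)] s by (simp add: D)
  next
    assume "\<not> test_val s (NLess (Cell ''p_in'' ''g'' ''zero'') (Cell ''p_out'' ''i'' ''zero''))"
    then have "min pk (q (offset A i + k)) = pk" using s by (simp add: D)
    then show "reverse_state A q x i k 0 (min pk (q (offset A i + k))) s \<and>
        ivar s ''i'' = i \<and> ivar s ''k'' = k \<and> ivar s ''K_i'' = steps A i"
      using s by simp
  qed
qed

lemma reverse_alloc:
  assumes s: "reverse_state A q x i k 0 pk s" "i < goods A" "k < steps A i"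
    "ivar s ''i'' = i" "ivar s ''k'' = k" "ivar s ''K_i'' = steps A i"
    and Q: "\<And>s. reverse_state A q x i k (bids A) pk s \<Longrightarrow>
      ivar s ''i'' = i \<Longrightarrow> ivar s ''k'' = k \<Longrightarrow> ivar s ''K_i'' = steps A i \<Longrightarrow> Q s"
  shows "wp reverse_alloc_prog Q s"
  unfolding reverse_alloc_prog_def
proof (rule wp_for[where N = "bids A" and J = "\<lambda>j s. reverse_state A q x i k j pk s \<and>
    ivar s ''j'' = j \<and> ivar s ''i'' = i \<and> ivar s ''k'' = k \<and> ivar s ''K_i'' = steps A i"])
  fix j s assume j: "j < bids A" and J: "reverse_state A q x i k j pk s \<and>
    ivar s ''j'' = j \<and> ivar s ''i'' = i \<and> ivar s ''k'' = k \<and> ivar s ''K_i'' = steps A i"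
  note o = offset_less_total[OF s(2,3)]
  have val: "cell_val s (Cell ''x_out'' ''j'' ''i'') + cell_val s (Cell ''x_in'' ''j'' ''g'') =
      (\<Sum>k<Suc k. x j (offset A i + k))"
    using J j o reverse_stateD(5)[of A q x i k j pk s] reverse_stateD(8,10)[of A q x i k j pk s]
    by simp
  have "reverse_state A q x i k (Suc j) pk
    (put_num (Cell ''x_out'' ''j'' ''i'') (\<Sum>k<Suc k. x j (offset A i + k)) s)"
    using J j by (intro reverse_state_alloc) auto
  with J s(2,3) j show "wp (NSet (Cell ''x_out'' ''j'' ''i'') (NAdd (Cell ''x_out'' ''j'' ''i'') (Cell ''x_in'' ''j'' ''g'')))
    (\<lambda>s'. ivar s' ''j'' = j \<and> ivar s' ''one'' = 1 \<and>
      reverse_state A q x i k (Suc j) pk (put_idx ''j'' 0 (Suc j) s') \<and>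
      ivar (put_idx ''j'' 0 (Suc j) s') ''j'' = Suc j \<and> ivar (put_idx ''j'' 0 (Suc j) s') ''i'' = i \<and>
      ivar (put_idx ''j'' 0 (Suc j) s') ''k'' = k \<and> ivar (put_idx ''j'' 0 (Suc j) s') ''K_i'' = steps A i) s"
    using sums[of i j "Suc k"]
    by (intro wp_nadd; simp only: val) (auto simp: reverse_stateD simp del: sum.lessThan_Suc)
qed (use s Q sizes_le[OF A dim] in \<open>auto simp: reverse_stateD\<close>)

lemma reverse_good:
  assumes s: "reverse_state A q x i 0 0 0 s" "i < goods A" "ivar s ''i'' = i"
  shows "wp reverse_good_prog (\<lambda>s'. reverse_state A q x (Suc i) 0 0 0 s' \<and> ivar s' ''i'' = i) s"
  unfolding reverse_good_prog_def
proof (intro wp_seq wp_iset wp_ncopy)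
  \<comment> \<open>Inserting the first price makes the minimum defined at \<open>k = 0\<close>,
    where it agrees with the initialization; after all steps the insertion is absorbed.\<close>
  define pmin where "pmin = (\<lambda>k. Min (insert (q (offset A i)) ((\<lambda>h. q (offset A i + h)) ` {..<k})))"
  have pmin_Suc: "min (pmin k) (q (offset A i + k)) = pmin (Suc k)" for k
    by (simp add: pmin_def lessThan_Suc insert_commute[of "q (offset A i)"] min.commute)
  have K: "0 < steps A i" using A s(2) by (force simp: arctic_auction_def)
  then have "q (offset A i) \<in> (\<lambda>h. q (offset A i + h)) ` {..<steps A i}"
    by (intro image_eqI[of _ _ 0]) auto
  then have pmin_K: "pmin (steps A i) = fst (recover (A, q, x)) i"
    using s(2) by (simp add: pmin_def recover_def insert_absorb)
  show "index_val s (IGet ''K'' ''i'') \<le> B"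
    using s sizes_le[OF A dim] by (simp add: reverse_stateD)
  let ?s = "put_idx ''K_i'' 0 (index_val s (IGet ''K'' ''i'')) s"
  let ?t = "put_num (Cell ''p_out'' ''i'' ''zero'') (cell_val ?s (Cell ''p_in'' ''g'' ''zero'')) ?s"
  have t: "reverse_state A q x i 0 0 (pmin 0) ?t"
    using reverse_state_price[of A q x i 0 0 0 ?s] s offset_less_total[OF s(2) K]
    by (simp add: reverse_stateD pmin_def)
  show "wp (for_loop ''k'' ''K_i''
      (Seq reverse_price_prog (Seq reverse_alloc_prog (ISet ''g'' (IAdd ''g'' ''one'')))))
    (\<lambda>s'. reverse_state A q x (Suc i) 0 0 0 s' \<and> ivar s' ''i'' = i) ?t"
  proof (rule wp_for[where N = "steps A i" and J = "\<lambda>k s. reverse_state A q x i k 0 (pmin k) s \<and>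
      ivar s ''i'' = i \<and> ivar s ''k'' = k \<and> ivar s ''K_i'' = steps A i"])
    fix k s assume k: "k < steps A i" and J: "reverse_state A q x i k 0 (pmin k) s \<and>
      ivar s ''i'' = i \<and> ivar s ''k'' = k \<and> ivar s ''K_i'' = steps A i"
    have le: "Suc (offset A i + k) \<le> B" using offset_less_total[OF s(2) k] dim by simp
    let ?Q = "\<lambda>s'. ivar s' ''k'' = k \<and> ivar s' ''one'' = 1 \<and>
        reverse_state A q x i (Suc k) 0 (pmin (Suc k)) (put_idx ''k'' 0 (Suc k) s') \<and>
        ivar (put_idx ''k'' 0 (Suc k) s') ''i'' = i \<and> ivar (put_idx ''k'' 0 (Suc k) s') ''k'' = Suc k \<and>
        ivar (put_idx ''k'' 0 (Suc k) s') ''K_i'' = steps A i"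
    show "wp (Seq reverse_price_prog (Seq reverse_alloc_prog (ISet ''g'' (IAdd ''g'' ''one'')))) ?Q s"
    proof (rule wp_seq, rule wp_mono[OF reverse_price[where k = k and pk = "pmin k"]])
      fix s assume "reverse_state A q x i k 0 (min (pmin k) (q (offset A i + k))) s \<and>
        ivar s ''i'' = i \<and> ivar s ''k'' = k \<and> ivar s ''K_i'' = steps A i"
      then show "wp (Seq reverse_alloc_prog (ISet ''g'' (IAdd ''g'' ''one''))) ?Q s"
        using s(2) k le
        by (intro wp_seq reverse_alloc wp_iset)
          (auto simp: pmin_Suc reverse_stateD reverse_state_next_step)
    qed (use J k s(2) in auto)
  next
    fix s assume "reverse_state A q x i (steps A i) 0 (pmin (steps A i)) s \<and>
      ivar s ''i'' = i \<and> ivar s ''k'' = steps A i \<and> ivar s ''K_i'' = steps A i"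
    then show "reverse_state A q x (Suc i) 0 0 0 s \<and> ivar s ''i'' = i"
      using reverse_state_next_good by (simp add: pmin_K)
  qed (use s t sizes_le[OF A dim] in \<open>auto simp: reverse_stateD\<close>)
qed

lemma reverse_correct:
  "wp reverse_prog (\<lambda>s. read_outcome s = recover (A, q, x)) (load_with_outcome A (reduced A) q x)"
  unfolding reverse_prog_def
proof (rule wp_seq, rule wp_iset)
  let ?s = "load_with_outcome A (reduced A) q x"
  show "index_val ?s (IConst 1) \<le> B" using B by simp
  show "wp (for_loop ''i'' ''n'' reverse_good_prog) (\<lambda>s. read_outcome s = recover (A, q, x))
    (put_idx ''one'' 0 (index_val ?s (IConst 1)) ?s)"
  proof (rule wp_for[where N = "goods A" and J = "\<lambda>i s. reverse_state A q x i 0 0 0 s \<and> ivar s ''i'' = i"])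
    fix i s assume "i < goods A" "reverse_state A q x i 0 0 0 s \<and> ivar s ''i'' = i"
    then show "wp reverse_good_prog (\<lambda>s'. ivar s' ''i'' = i \<and> ivar s' ''one'' = 1 \<and>
        reverse_state A q x (Suc i) 0 0 0 (put_idx ''i'' 0 (Suc i) s') \<and>
        ivar (put_idx ''i'' 0 (Suc i) s') ''i'' = Suc i) s"
      by (auto simp: reverse_stateD intro!: wp_mono[OF reverse_good])
  qed (use load_with_outcome_state[of A q x] sizes_le[OF A dim] in \<open>auto simp: reverse_stateD read_recover\<close>)
qed

end
end

section \<open>The two maps are strongly polynomial\<close>

lemma load_with_outcome_bounded:
  assumes A: "rational_auction A" "rational_outcome B p x"
    and C: "auction_len A + outcome_len B p x + 3 \<le> C"
  shows "numbers_bounded C (load_with_outcome A B p x)"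
proof -
  have "numbers_bounded C (load_auction A)" using A C by (intro load_auction_bounded) auto
  moreover have "num_len (p i) \<le> C" if "i < goods B" for i
    using member_le_sum[of i "{..<goods B}" "\<lambda>i. num_len (p i)"] that C by (simp add: outcome_len_def)
  moreover have "num_len (x j i) \<le> C" if "j < bids B" "i < goods B" for i j
    using member_le_sum2[of j "bids B" i "\<lambda>_. goods B" "\<lambda>j i. num_len (x j i)"] that C
    by (simp add: outcome_len_def)
  ultimately show ?thesis
    using A(2) by (auto simp: numbers_bounded_def load_with_outcome_def rational_outcome_def)
qed

text \<open>Each intermediate value of the accumulation must be short. Its terms are distinct
  entries of the given outcome, so their lengths add up to at most
  \<open>outcome_len\<close>.\<close>

lemma partial_sum_bounded:
  assumes r: "rational_outcome (reduced A) p x" and ij: "i < goods A" "j < bids A" "k \<le> steps A i"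
  shows "(\<Sum>k<k. x j (offset A i + k)) \<in> \<rat> \<and>
    num_len (\<Sum>k<k. x j (offset A i + k)) \<le> 2 * outcome_len (reduced A) p x + 3"
proof (rule sizedD, rule sized_mono)
  have "x j (offset A i + h) \<in> \<rat>" if "h < k" for h
    using r ij that offset_less_total[of i A h] by (simp add: rational_outcome_def)
  then show "sized (\<Sum>h<k. num_len (x j (offset A i + h))) (\<Sum>k<k. x j (offset A i + k))"
    by (rule sized_sum)
  have "(\<Sum>h<k. num_len (x j (offset A i + h))) \<le> (\<Sum>h<steps A i. num_len (x j (offset A i + h)))"
    using ij by (intro sum_mono2) auto
  also have "\<dots> \<le> (\<Sum>i<goods A. \<Sum>h<steps A i. num_len (x j (offset A i + h)))"
    using ij member_le_sum[of i "{..<goods A}" "\<lambda>i. \<Sum>h<steps A i. num_len (x j (offset A i + h))"] by simp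
  also have "\<dots> = (\<Sum>g<total_steps A. num_len (x j g))"
    unfolding total_steps_def sum_offset ..
  also have "\<dots> \<le> outcome_len (reduced A) p x"
    using ij member_le_sum[of j "{..<bids A + total_steps A}" "\<lambda>j. \<Sum>g<total_steps A. num_len (x j g)"]
    by (simp add: outcome_len_def)
  finally show "(\<Sum>h<k. num_len (x j (offset A i + h))) \<le> outcome_len (reduced A) p x" .
qed

theorem forward_strongly_polynomial: "strongly_polynomial_forward reduced"
  unfolding strongly_polynomial_forward_def
\<comment> \<open>The polynomial \<open>3 + 2 * l\<close> is the bound of \<open>sizedD\<close> at
  the encoding length \<open>l\<close>.\<close>
proof (rule strongly_polynomialI[where Q = "[:3, 2:]" and c = forward_prog])
  fix A assume "A \<in> stepwise_inputs"
  then have A: "arctic_auction A" "rational_auction A" by (auto simp: stepwise_inputs_def)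
  let ?B = "poly [:3, 2:] (auction_len A)"
  show "numbers_bounded ?B (load_auction A)"
    using A by (intro load_auction_bounded) auto
  interpret bounded_machine "rational_auction A" ?B "auction_dim A"
    by unfold_locales simp
  show "wp forward_prog (\<lambda>s. read_auction s = reduced A) (load_auction A)"
  proof (rule forward_correct[OF A(1)])
    show "bids A + total_steps A \<le> ?B" using dim_le_auction_len[of A] by simp
    fix i k assume ik: "i < goods A" "k < steps A i"
    have "sized (num_len (mcost A i k) + num_len (width A i k)) (mcost A i k * width A i k)"
      using A(2) ik by (intro sized_add_mult sized_num_len) (auto simp: rational_auction_def)
    then show "mcost A i k * width A i k \<in> \<rat> \<and> num_len (mcost A i k * width A i k) \<le> ?B"
      using sizedD data_le_auction_len(5)[OF ik] by fastforce
  qed simp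
qed simp

theorem reverse_strongly_polynomial: "strongly_polynomial_reverse reduced recover"
  unfolding strongly_polynomial_reverse_def
proof (rule strongly_polynomialI[where Q = "[:3, 2:]" and c = reverse_prog], goal_cases)
  case (2 y)
  then show ?case by (auto intro!: load_with_outcome_bounded)
next
  case (3 y)
  obtain A p x where y: "y = (A, p, x)" by (cases y)
  have A: "arctic_auction A" using 3 y by (auto simp: stepwise_inputs_def)
  \<comment> \<open>For an irrational equilibrium \<open>?R\<close> is false and \<open>ok\<close>
    holds trivially, so the same derivation still bounds the number of operations.\<close>
  let ?R = "rational_auction A \<and> rational_outcome (reduced A) p x"
  let ?B = "poly [:3, 2:] (auction_len A + outcome_len (reduced A) p x)"
  interpret bounded_machine ?R ?B "auction_dim A"
    by unfold_locales simp
  have "wp reverse_prog (\<lambda>s. read_outcome s = recover (A, p, x)) (load_with_outcome A (reduced A) p x)"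
  proof (rule reverse_correct[OF A])
    show "bids A + total_steps A \<le> ?B" using dim_le_auction_len[of A] by simp
    fix i j k assume "?R" "i < goods A" "j < bids A" "k \<le> steps A i"
    then show "(\<Sum>k<k. x j (offset A i + k)) \<in> \<rat> \<and> num_len (\<Sum>k<k. x j (offset A i + k)) \<le> ?B"
      using partial_sum_bounded[of A p x i j k] by force
  qed simp
  then show ?case by (simp add: y)
qed simp

theorem theorem1:
  "\<exists>(F :: auction \<Rightarrow> auction)
     (G :: auction \<times> (nat \<Rightarrow> real) \<times> (nat \<Rightarrow> nat \<Rightarrow> real)
           \<Rightarrow> (nat \<Rightarrow> real) \<times> (nat \<Rightarrow> nat \<Rightarrow> real)).
     strongly_polynomial_forward F \<and>
     (\<forall>A\<in>stepwise_inputs. arctic_auction (F A) \<and> costless (F A) \<and>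
        (\<exists>p x. competitive_equilibrium (F A) p x)) \<and>
     strongly_polynomial_reverse F G \<and>
     (\<forall>A\<in>stepwise_inputs. \<forall>p x. competitive_equilibrium (F A) p x \<longrightarrow>
        (case G (A, p, x) of (p', x') \<Rightarrow> competitive_equilibrium A p' x'))"
proof (intro exI conjI)
  show "strongly_polynomial_forward reduced"
    by (rule forward_strongly_polynomial)
  show "strongly_polynomial_reverse reduced recover"
    by (rule reverse_strongly_polynomial)
  show "\<forall>A\<in>stepwise_inputs. arctic_auction (reduced A) \<and> costless (reduced A) \<and>
      (\<exists>p x. competitive_equilibrium (reduced A) p x)"
    using arctic_reduced costless_reduced costless_equilibrium_exists
    by (auto simp: stepwise_inputs_def)
  show "\<forall>A\<in>stepwise_inputs. \<forall>p x. competitive_equilibrium (reduced A) p x \<longrightarrow>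
      (case recover (A, p, x) of (p', x') \<Rightarrow> competitive_equilibrium A p' x')"
    using recover_equilibrium by (auto simp: stepwise_inputs_def split: prod.split)
qed

end
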